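(* Let $M$ be an $n$-dimensional $C^2$-smooth manifold and $f\colon M\to\mathbb{R}$ a $C^2$-smooth function. Let $p^*\in M$ be a non-degenerate critical point of $f$, that is, $Df(p^* )=0$ and the Hessian bilinear form $D^2f(p^* )$ is non-degenerate. Assume there are a chart $(U,\varphi)$ on $M$ with $p^*\in U$ and $\varphi(p^* )=0$, and an $\eta>0$, such that $\widehat f=f\circ\varphi^{-1}$ satisfies $$\|[H_{\widehat f}(x)-H_{\widehat f}(0)]\,x\|\le \eta\|x\|^2\qquad\text{for all }x\in\varphi(U).$$ Let $\phi,\psi\colon TM\to M$ satisfy conditions C1--C2 (defined in the context). Then the generalised Newton iteration function $$E_f(p)=\psi_p\circ N_{f\circ\phi_p}(0_p)$$ converges locally quadratically to $p^*$.
   Context: Notation. $\|\cdot\|$ is the Euclidean norm on $\mathbb{R}^n$, $B(x;\rho)$ the open ball; $\nabla g$, $H_g$ are the Euclidean gradient and Hessian of $g$; for a second derivative, $\|D^2h(x)\|=\sup_{\|\eta\|=1}\|D^2h(x)\cdot(\eta,\eta)\|$. The Newton iteration function of a real function $g$ is $N_g(x)=x-[H_g(x)]^{-1}\nabla g(x)$; it does not depend on the inner product used to define gradient and Hessian, so it makes sense on any finite-dimensional real vector space, in particular on $T_pM$. Only the first and second derivatives of $g$ at the point $x$ are needed to define $N_g(x)$. Iteration functions may be only partially defined. $0_p$ is the zero of $T_pM$, and $\phi_p,\psi_p\colon T_pM\to M$ are the restrictions of $\phi,\psi\colon TM\to M$ to $T_pM$ ($\phi,\psi$ are not assumed continuous).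 Convergence. An iteration function $N$ on $\mathbb{R}^n$ converges locally to $x^*$ with rate $K>1$ if there are $\kappa\in\mathbb{R}$ and an open $U\ni x^*$ such that $N$ is defined on $U$ and for all $x\in U$: $N(x)\in U$ and $\|N(x)-x^*\|\le\kappa\|x-x^*\|^K$; quadratic means $K=2$. An iteration function $E$ on a $C^1$-manifold $M$ converges locally with rate $K>1$ to $p^*$ if there is a coordinate chart $\varphi$ defined on a neighbourhood of $p^*$ such that $\varphi\circ E\circ\varphi^{-1}$ converges locally with rate $K$ to $\varphi(p^* )$. Induced charts. Let $\pi\colon TM\to M$ be the bundle projection. A $C^2$-chart $(U,\varphi)$ of $M$ induces the chart $\tau_\varphi\colon\pi^{-1}(U)\to\mathbb{R}^n\times\mathbb{R}^n$, $v_p\mapsto(\varphi(p),A_p(v_p))$, where $A_p\colon T_pM\to\mathbb{R}^n$ sends $\sum_j\eta^j\,\partial/\partial\varphi_j|_p$ to $(\eta^1,\dots,\eta^n)$. Conditions H1--H3. Let $h\colon\mathbb{R}^n\times\mathbb{R}^n\to\mathbb{R}^n$ be a possibly partially defined function and write $h_x(y)=h(x,y)$. H1$_\rho$: $x\in B(0;\rho)$ implies $h_x(0)=x$ and $Dh_x(0)=I$. H2$_\rho$: there is $\alpha\in\mathbb{R}$ with $\|D^2h_x(0)\|\le\alpha$ for every $x\in B(0;\rho)$ (existence of $D^2h_x(0)$ is part of the condition). H3$_\rho$: there is $\beta\in\mathbb{R}$ such that $\|h_x(y)-x-y\|\le\beta\|y\|^2$ for all $x,y\in B(0;\rho)$.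 For H1$_\rho$ and H2$_\rho$ the domain of $h$ must contain a set $\{(x,y)\mid x\in B(0;\rho),\ y\in B(0;\delta_x)\}$ with some $\delta_x>0$ depending on $x$; for H3$_\rho$ it must contain $B(0;\rho)\times B(0;\rho)$. Conditions C1--C2. $\phi,\psi\colon TM\to M$ satisfy C1--C2 if for every $p\in M$ there exist a $C^2$-chart $(U,\varphi)$ with $\varphi(p)=0$ and a $\rho>0$ such that: (C1) $\widehat\phi=\varphi\circ\phi\circ\tau_\varphi^{-1}$ satisfies H1$_\rho$ and H2$_\rho$; (C2) $\widehat\psi=\varphi\circ\psi\circ\tau_\varphi^{-1}$ satisfies H3$_\rho$. *)

theory Defs
  imports "HOL-Analysis.Analysis"
begin

section \<open>Second derivatives, gradient, Hessian and Newton iteration on Euclidean space\<close>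

definition has_second_derivative ::
    "('a::real_normed_vector \<Rightarrow> 'b::real_normed_vector) \<Rightarrow> ('a \<Rightarrow>\<^sub>L 'a \<Rightarrow>\<^sub>L 'b) \<Rightarrow> 'a \<Rightarrow> bool" where
  "has_second_derivative g B x \<longleftrightarrow>
     (\<exists>D. (\<forall>\<^sub>F y in nhds x. (g has_derivative blinfun_apply (D y)) (at y)) \<and>
          (D has_derivative blinfun_apply B) (at x))"

definition second_derivative ::
    "('a::real_normed_vector \<Rightarrow> 'b::real_normed_vector) \<Rightarrow> 'a \<Rightarrow> ('a \<Rightarrow>\<^sub>L 'a \<Rightarrow>\<^sub>L 'b)" where
  "second_derivative g x = (THE B. has_second_derivative g B x)"

definition second_derivative_norm ::
    "('a::real_normed_vector \<Rightarrow>\<^sub>L 'a \<Rightarrow>\<^sub>L 'b::real_normed_vector) \<Rightarrow> real" where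
  "second_derivative_norm B = (SUP \<eta>\<in>sphere 0 1. norm (B \<eta> \<eta>))"

text \<open>Only meant for open \<open>S\<close>.\<close>
definition C2_on :: "'a::real_normed_vector set \<Rightarrow> ('a \<Rightarrow> 'b::real_normed_vector) \<Rightarrow> bool" where
  "C2_on S g \<longleftrightarrow>
     (\<exists>(D :: 'a \<Rightarrow> 'a \<Rightarrow>\<^sub>L 'b) (D2 :: 'a \<Rightarrow> 'a \<Rightarrow>\<^sub>L 'a \<Rightarrow>\<^sub>L 'b).
        (\<forall>x\<in>S. (g has_derivative blinfun_apply (D x)) (at x)) \<and>
        (\<forall>x\<in>S. (D has_derivative blinfun_apply (D2 x)) (at x)) \<and>
        continuous_on S D2)"

definition gradient :: "(real^'n \<Rightarrow> real) \<Rightarrow> real^'n \<Rightarrow> real^'n" where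
  "gradient g x = (THE d. GDERIV g x :> d)"

definition hessian :: "(real^'n \<Rightarrow> real) \<Rightarrow> real^'n \<Rightarrow> real^'n^'n" where
  "hessian g x = (\<chi> i j. second_derivative g x (axis i 1) (axis j 1))"

definition newton :: "(real^'n \<Rightarrow> real) \<Rightarrow> real^'n \<rightharpoonup> real^'n" where
  "newton g x =
     (if (\<exists>B. has_second_derivative g B x) \<and> invertible (hessian g x)
      then Some (x - matrix_inv (hessian g x) *v gradient g x)
      else None)"

definition converges_locally :: "real \<Rightarrow> (real^'n \<rightharpoonup> real^'n) \<Rightarrow> real^'n \<Rightarrow> bool" where
  "converges_locally K N x0 \<longleftrightarrow> K > 1 \<and>
     (\<exists>\<kappa> U. open U \<and> x0 \<in> U \<and>
        (\<forall>x\<in>U. \<exists>y. N x = Some y \<and> y \<in> U \<and> norm (y - x0) \<le> \<kappa> * norm (x - x0) powr K))"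


section \<open>Manifolds of class $C^2$\<close>

text \<open>The underlying set of the manifold is a whole type; the manifold structure is given by
  an atlas. A chart is a pair of its domain and its coordinate map, the latter being irrelevant
  outside the domain.\<close>

type_synonym ('m, 'n) chart = "'m set \<times> ('m \<Rightarrow> real^'n)"

abbreviation chart_inv :: "('m, 'n::finite) chart \<Rightarrow> real^'n \<Rightarrow> 'm" where
  "chart_inv c \<equiv> inv_into (fst c) (snd c)"

definition chart :: "('m::topological_space, 'n::finite) chart \<Rightarrow> bool" where
  "chart c \<longleftrightarrow> open (fst c) \<and> open (snd c ` fst c) \<and>
     homeomorphism (fst c) (snd c ` fst c) (snd c) (chart_inv c)"

definition C2_transition ::
    "('m, 'n::finite) chart \<Rightarrow> ('m, 'n) chart \<Rightarrow> bool" where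
  "C2_transition c d \<longleftrightarrow> C2_on (snd c ` (fst c \<inter> fst d)) (snd d \<circ> chart_inv c)"

definition C2_manifold ::
    "('m::{t2_space, second_countable_topology}, 'n::finite) chart set \<Rightarrow> bool" where
  "C2_manifold \<A> \<longleftrightarrow> (\<forall>c\<in>\<A>. chart c) \<and> (\<Union>c\<in>\<A>. fst c) = UNIV \<and>
     (\<forall>c\<in>\<A>. \<forall>d\<in>\<A>. C2_transition c d)"

text \<open>The charts of the maximal $C^2$-atlas containing \<open>\<A>\<close>.\<close>
definition C2_chart ::
    "('m::topological_space, 'n::finite) chart set \<Rightarrow> ('m, 'n) chart \<Rightarrow> bool" where
  "C2_chart \<A> c \<longleftrightarrow> chart c \<and> (\<forall>d\<in>\<A>. C2_transition c d \<and> C2_transition d c)"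

definition C2_function ::
    "('m::topological_space, 'n::finite) chart set \<Rightarrow> ('m \<Rightarrow> real) \<Rightarrow> bool" where
  "C2_function \<A> f \<longleftrightarrow> (\<forall>c\<in>\<A>. C2_on (snd c ` fst c) (f \<circ> chart_inv c))"


section \<open>The tangent bundle\<close>

text \<open>Tangent vectors at \<open>p\<close> are the linear combinations of the directional derivative operators
  \<open>\<partial>/\<partial>\<phi>\<^sub>j\<close> at \<open>p\<close>, acting on the functions that are differentiable at \<open>p\<close> (differentiability at
  \<open>p\<close> is independent of the chart; the value on all other functions is set to 0). The vector
  space operations are pointwise. All derivations would be too many for a manifold of finite
  differentiability class.\<close>

type_synonym 'm tangent_vector = "('m \<Rightarrow> real) \<Rightarrow> real"

definition coord_vector :: "('m, 'n::finite) chart \<Rightarrow> 'm \<Rightarrow> 'n \<Rightarrow> 'm tangent_vector" where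
  "coord_vector c p j g =
     (if (g \<circ> chart_inv c) differentiable (at (snd c p))
      then frechet_derivative (g \<circ> chart_inv c) (at (snd c p)) (axis j 1) else 0)"

definition coord_combination ::
    "('m, 'n::finite) chart \<Rightarrow> 'm \<Rightarrow> real^'n \<Rightarrow> 'm tangent_vector" where
  "coord_combination c p \<eta> = (\<lambda>g. \<Sum>j\<in>UNIV. \<eta> $ j * coord_vector c p j g)"

definition tangent_space ::
    "('m::topological_space, 'n::finite) chart set \<Rightarrow> 'm \<Rightarrow> 'm tangent_vector set" where
  "tangent_space \<A> p = {coord_combination c p \<eta> | c \<eta>. C2_chart \<A> c \<and> p \<in> fst c}"

abbreviation zero_vector :: "'m tangent_vector" where
  "zero_vector \<equiv> (\<lambda>g. 0)"

definition tangent_bundle ::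
    "('m::topological_space, 'n::finite) chart set \<Rightarrow> ('m \<times> 'm tangent_vector) set" where
  "tangent_bundle \<A> = (SIGMA p:UNIV. tangent_space \<A> p)"

definition tangent_coords ::
    "('m, 'n::finite) chart \<Rightarrow> 'm \<Rightarrow> 'm tangent_vector \<Rightarrow> real^'n" where
  "tangent_coords c p v = (THE \<eta>. v = coord_combination c p \<eta>)"

definition bundle_chart ::
    "('m, 'n::finite) chart \<Rightarrow> 'm \<times> 'm tangent_vector \<Rightarrow> (real^'n) \<times> (real^'n)" where
  "bundle_chart c = (\<lambda>(p, v). (snd c p, tangent_coords c p v))"

definition bundle_chart_dom ::
    "('m::topological_space, 'n::finite) chart set \<Rightarrow> ('m, 'n) chart \<Rightarrow>
     ('m \<times> 'm tangent_vector) set" where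
  "bundle_chart_dom \<A> c = {z \<in> tangent_bundle \<A>. fst z \<in> fst c}"


section \<open>Critical points\<close>

text \<open>The differential of \<open>f\<close> at \<open>p\<close> sends \<open>v\<close> to \<open>v f\<close>.\<close>
definition critical_point ::
    "('m::topological_space, 'n::finite) chart set \<Rightarrow> ('m \<Rightarrow> real) \<Rightarrow> 'm \<Rightarrow> bool" where
  "critical_point \<A> f p \<longleftrightarrow> (\<forall>v\<in>tangent_space \<A> p. v f = 0)"

text \<open>Only meaningful at critical points, where the value is the same in all charts.\<close>
definition hessian_form ::
    "('m::topological_space, 'n::finite) chart set \<Rightarrow> ('m \<Rightarrow> real) \<Rightarrow> 'm \<Rightarrow>
     'm tangent_vector \<Rightarrow> 'm tangent_vector \<Rightarrow> real" where
  "hessian_form \<A> f p u v =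
     (THE b. \<forall>c. C2_chart \<A> c \<and> p \<in> fst c \<longrightarrow>
        b = second_derivative (f \<circ> chart_inv c) (snd c p)
              (tangent_coords c p u) (tangent_coords c p v))"

definition nondegenerate_critical_point ::
    "('m::topological_space, 'n::finite) chart set \<Rightarrow> ('m \<Rightarrow> real) \<Rightarrow> 'm \<Rightarrow> bool" where
  "nondegenerate_critical_point \<A> f p \<longleftrightarrow> critical_point \<A> f p \<and>
     (\<forall>u\<in>tangent_space \<A> p.
        (\<forall>v\<in>tangent_space \<A> p. hessian_form \<A> f p u v = 0) \<longrightarrow> u = zero_vector)"


section \<open>Newton iteration on tangent spaces and on the manifold\<close>

definition tangent_iso ::
    "('m::topological_space, 'n::finite) chart set \<Rightarrow> 'm \<Rightarrow> ('m tangent_vector \<Rightarrow> real^'n) \<Rightarrow> bool"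
  where
  "tangent_iso \<A> p L \<longleftrightarrow> bij_betw L (tangent_space \<A> p) UNIV \<and>
     (\<forall>u\<in>tangent_space \<A> p. \<forall>v\<in>tangent_space \<A> p. L (\<lambda>g. u g + v g) = L u + L v) \<and>
     (\<forall>a. \<forall>v\<in>tangent_space \<A> p. L (\<lambda>g. a * v g) = a *\<^sub>R L v)"

text \<open>Choosing an inner product on a tangent space together with an orthonormal basis amounts to
  choosing a linear isomorphism onto Euclidean space, under which gradient and Hessian become
  the Euclidean ones. The Newton iteration does not depend on this choice.\<close>
definition tangent_newton ::
    "('m::topological_space, 'n::finite) chart set \<Rightarrow> 'm \<Rightarrow> ('m tangent_vector \<Rightarrow> real) \<Rightarrow>
     'm tangent_vector \<rightharpoonup> 'm tangent_vector" where
  "tangent_newton \<A> p g v =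
     (let L = (SOME L. tangent_iso \<A> p L); L' = inv_into (tangent_space \<A> p) L
      in map_option L' (newton (g \<circ> L') (L v)))"

definition generalised_newton ::
    "('m::topological_space, 'n::finite) chart set \<Rightarrow>
     ('m \<times> 'm tangent_vector \<Rightarrow> 'm) \<Rightarrow> ('m \<times> 'm tangent_vector \<Rightarrow> 'm) \<Rightarrow> ('m \<Rightarrow> real) \<Rightarrow> 'm \<rightharpoonup> 'm"
  where
  "generalised_newton \<A> \<phi> \<psi> f p =
     map_option (\<lambda>v. \<psi> (p, v)) (tangent_newton \<A> p (\<lambda>v. f (\<phi> (p, v))) zero_vector)"

definition manifold_converges_locally ::
    "('m::topological_space, 'n::finite) chart set \<Rightarrow> real \<Rightarrow> ('m \<rightharpoonup> 'm) \<Rightarrow> 'm \<Rightarrow> bool" where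
  "manifold_converges_locally \<A> K E p \<longleftrightarrow>
     (\<exists>c. C2_chart \<A> c \<and> p \<in> fst c \<and>
        converges_locally K
          (((Some \<circ> snd c) |` fst c) \<circ>\<^sub>m E \<circ>\<^sub>m ((Some \<circ> chart_inv c) |` (snd c ` fst c)))
          (snd c p))"


section \<open>The conditions on the two families of parametrisations\<close>

text \<open>Differentiability at 0 of \<open>the \<circ> h_x\<close> only involves values of \<open>h\<close> inside its domain,
  because that domain is required to contain a neighbourhood of 0.\<close>

definition H1 :: "real \<Rightarrow> ((real^'n) \<times> (real^'n) \<rightharpoonup> real^'n) \<Rightarrow> bool" where
  "H1 \<rho> h \<longleftrightarrow>
     (\<forall>x\<in>ball 0 \<rho>. (\<exists>\<delta>>0. {x} \<times> ball 0 \<delta> \<subseteq> dom h) \<and>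
        h (x, 0) = Some x \<and> ((\<lambda>y. the (h (x, y))) has_derivative id) (at 0))"

definition H2 :: "real \<Rightarrow> ((real^'n) \<times> (real^'n) \<rightharpoonup> real^'n) \<Rightarrow> bool" where
  "H2 \<rho> h \<longleftrightarrow>
     (\<exists>\<alpha>. \<forall>x\<in>ball 0 \<rho>. (\<exists>\<delta>>0. {x} \<times> ball 0 \<delta> \<subseteq> dom h) \<and>
        (\<exists>B. has_second_derivative (\<lambda>y. the (h (x, y))) B 0 \<and> second_derivative_norm B \<le> \<alpha>))"

definition H3 :: "real \<Rightarrow> ((real^'n) \<times> (real^'n) \<rightharpoonup> real^'n) \<Rightarrow> bool" where
  "H3 \<rho> h \<longleftrightarrow> ball 0 \<rho> \<times> ball 0 \<rho> \<subseteq> dom h \<and>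
     (\<exists>\<beta>. \<forall>x\<in>ball 0 \<rho>. \<forall>y\<in>ball 0 \<rho>. norm (the (h (x, y)) - x - y) \<le> \<beta> * (norm y)\<^sup>2)"

definition local_form ::
    "('m::topological_space, 'n::finite) chart set \<Rightarrow> ('m, 'n) chart \<Rightarrow>
     ('m \<times> 'm tangent_vector \<Rightarrow> 'm) \<Rightarrow> (real^'n) \<times> (real^'n) \<rightharpoonup> real^'n" where
  "local_form \<A> c \<phi> =
     ((Some \<circ> snd c) |` fst c) \<circ>\<^sub>m (Some \<circ> \<phi>) \<circ>\<^sub>m
     ((Some \<circ> inv_into (bundle_chart_dom \<A> c) (bundle_chart c))
        |` (bundle_chart c ` bundle_chart_dom \<A> c))"

definition conditions_C1_C2 ::
    "('m::topological_space, 'n::finite) chart set \<Rightarrow>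
     ('m \<times> 'm tangent_vector \<Rightarrow> 'm) \<Rightarrow> ('m \<times> 'm tangent_vector \<Rightarrow> 'm) \<Rightarrow> bool" where
  "conditions_C1_C2 \<A> \<phi> \<psi> \<longleftrightarrow>
     (\<forall>p. \<exists>c \<rho>. C2_chart \<A> c \<and> p \<in> fst c \<and> snd c p = 0 \<and> \<rho> > 0 \<and>
        H1 \<rho> (local_form \<A> c \<phi>) \<and> H2 \<rho> (local_form \<A> c \<phi>) \<and> H3 \<rho> (local_form \<A> c \<psi>))"

end

theory Submission
  imports Defs
begin

text \<open>
  In a coordinate system centred at the critical point, Newton's method has the new point
  \<open>x + y\<close> with \<open>D\<^sup>2f(x) y = - Df(x)\<close>, so \<open>D\<^sup>2f(x)(x + y) = D\<^sup>2f(x) x - Df(x)\<close>, and quadratic convergence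
  amounts to the order condition \<open>D\<^sup>2f(x) x - Df(x) = O(\<parallel>x\<parallel>\<^sup>2)\<close>. The hypothesis on the Hessian
  yields this condition in the chart \<open>\<xi>\<close>, by integration along rays
  (\<open>order_condition_of_hessian_condition\<close>). At a critical point the condition survives a \<open>C\<^sup>2\<close> change of
  coordinates (\<open>order_condition_compose\<close>), so it also holds in the chart \<open>c\<close> in which the conditions on
  \<open>\<phi>\<close> and \<open>\<psi>\<close> are given; from there on everything takes place in \<open>c\<close>.

  Pulling \<open>f\<close> back along \<open>\<phi>\<^sub>p\<close> does not change the differential, because \<open>D\<phi>\<^sub>x(0) = I\<close>, and changes the
  Hessian by \<open>Df(x) \<circ> D\<^sup>2\<phi>\<^sub>x(0)\<close> (\<open>tangent_newton_of_pullback\<close>). The second factor is bounded, and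
  \<open>Df(x) = O(\<parallel>x\<parallel>)\<close> at a critical point, so the perturbed Hessian stays uniformly invertible and the
  perturbation costs another term of order \<open>\<parallel>x\<parallel>\<^sup>2\<close>: still \<open>x + y = O(\<parallel>x\<parallel>\<^sup>2)\<close>
  (\<open>perturbed_newton_step_estimate\<close>). Finally \<open>\<psi>\<close> sends the step to \<open>x + y + O(\<parallel>y\<parallel>\<^sup>2)\<close>, and
  \<open>y = O(\<parallel>x\<parallel>)\<close>.

  The Newton step on a tangent space is computed through an arbitrarily chosen linear isomorphism with
  \<open>\<real>\<^sup>n\<close>. It is characterised by the equation \<open>B(y, v) = - g'(v)\<close> for all \<open>v\<close> (\<open>newton_variational\<close>), in
  which linear isomorphisms cancel (\<open>tangent_newton_in_coords\<close>). Non-degeneracy is transported to \<open>c\<close> by the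
  chart independence of the Hessian at a critical point (\<open>hessian_form_in_chart\<close>). Symmetry of
  second derivatives extends the bound on the quadratic form of \<open>D\<^sup>2\<phi>\<^sub>x(0)\<close> to the whole bilinear form.
\<close>

section \<open>Second derivatives: symmetry, uniqueness and the chain rule\<close>

lemma norm_increment_le:
  fixes F :: "real \<Rightarrow> 'b::real_normed_vector"
  assumes "\<And>s. s \<in> {0..1} \<Longrightarrow> (F has_vector_derivative F' s) (at s)"
    and "\<And>s. s \<in> {0..1} \<Longrightarrow> norm (F' s) \<le> K"
  shows "norm (F 1 - F 0) \<le> K"
proof -
  have "norm (F 1 - F 0) \<le> K * norm (1 - 0 :: real)"
  proof (rule differentiable_bound[of "{0..1}" F "\<lambda>s h. h *\<^sub>R F' s"])
    fix s :: real assume s: "s \<in> {0..1}"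
    show "(F has_derivative (\<lambda>h. h *\<^sub>R F' s)) (at s within {0..1})"
      using assms(1)[OF s] by (auto simp: has_vector_derivative_def intro: has_derivative_at_withinI)
    show "onorm (\<lambda>h. h *\<^sub>R F' s) \<le> K"
    proof (rule onorm_le)
      fix h :: real
      show "norm (h *\<^sub>R F' s) \<le> K * norm h"
        using mult_left_mono[OF assms(2)[OF s], of "\<bar>h\<bar>"] by (simp add: mult.commute)
    qed
  qed auto
  then show ?thesis by simp
qed

lemma has_derivative_line:
  fixes g :: "'a::real_normed_vector \<Rightarrow> 'b::real_normed_vector"
  assumes "(g has_derivative blinfun_apply D) (at (x + s *\<^sub>R u))"
  shows "((\<lambda>s. g (x + s *\<^sub>R u)) has_vector_derivative D u) (at s)"
proof -
  have 1: "((\<lambda>s. x + s *\<^sub>R u) has_derivative (\<lambda>h. h *\<^sub>R u)) (at s)"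
    by (auto intro!: derivative_eq_intros)
  show ?thesis
    using has_derivative_compose[OF 1 assms]
    by (simp add: has_vector_derivative_def blinfun.bilinear_simps)
qed

text \<open>Both orders of differentiation approximate the same second difference: the mean value
  inequality for \<open>s \<mapsto> g(x + v + s u) - g(x + s u) - s B(v,u)\<close> on \<open>[0,1]\<close> compares it with \<open>B(v,u)\<close>,
  and the difference is symmetric in \<open>u\<close> and \<open>v\<close>. The estimate is derived from differentiability of \<open>D\<close>
  at the single point \<open>x\<close>, since the maps \<open>\<phi>\<^sub>x\<close> of the conditions have a second derivative at \<open>0\<close> only.\<close>
lemma second_difference_bound:
  fixes g :: "'a::real_normed_vector \<Rightarrow> 'b::real_normed_vector" and B :: "'a \<Rightarrow>\<^sub>L 'a \<Rightarrow>\<^sub>L 'b"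
  assumes g: "\<And>y. norm (y - x) < \<delta> \<Longrightarrow> (g has_derivative blinfun_apply (D y)) (at y)"
    and D: "\<And>y. norm (y - x) < \<delta> \<Longrightarrow> norm (D y - D x - B (y - x)) \<le> e * norm (y - x)"
    and uv: "norm u + norm v < \<delta>" and e: "e \<ge> 0"
  shows "norm (g (x + u + v) - g (x + u) - g (x + v) + g x - B v u) \<le> 2 * e * (norm u + norm v)\<^sup>2"
proof -
  let ?F = "\<lambda>s::real. g (x + v + s *\<^sub>R u) - g (x + s *\<^sub>R u) - s *\<^sub>R B v u"
  let ?N = "norm u + norm v"
  have small: "norm (s *\<^sub>R u) \<le> norm u" if "s \<in> {0..1}" for s
    using that by (simp add: mult_left_le_one_le)
  have "norm (?F 1 - ?F 0) \<le> 2 * e * ?N\<^sup>2"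
  proof (rule norm_increment_le)
    fix s :: real assume s: "s \<in> {0..1}"
    have n1: "norm (x + v + s *\<^sub>R u - x) \<le> ?N"
      using small[OF s] norm_triangle_ineq[of v "s *\<^sub>R u"] by (simp add: add.assoc)
    have n2: "norm (x + s *\<^sub>R u - x) \<le> ?N"
      using small[OF s] norm_ge_zero[of v] by (simp add: add_increasing2)
    show "(?F has_vector_derivative (D (x + v + s *\<^sub>R u) u - D (x + s *\<^sub>R u) u - B v u)) (at s)"
    proof (intro has_vector_derivative_diff has_derivative_line g)
      show "((\<lambda>s. s *\<^sub>R B v u) has_vector_derivative B v u) (at s)"
        by (auto intro!: derivative_eq_intros simp: has_vector_derivative_def)
    qed (use n1 n2 uv in linarith)+
    have "D (x + v + s *\<^sub>R u) u - D (x + s *\<^sub>R u) u - B v u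
       = ((D (x + v + s *\<^sub>R u) - D x - B (x + v + s *\<^sub>R u - x))
          - (D (x + s *\<^sub>R u) - D x - B (x + s *\<^sub>R u - x))) u"
      by (simp add: blinfun.bilinear_simps algebra_simps)
    also have "norm \<dots> \<le> norm ((D (x + v + s *\<^sub>R u) - D x - B (x + v + s *\<^sub>R u - x))
          - (D (x + s *\<^sub>R u) - D x - B (x + s *\<^sub>R u - x))) * norm u"
      by (rule norm_blinfun)
    also have "\<dots> \<le> (e * ?N + e * ?N) * ?N"
    proof (rule mult_mono)
      have "norm (D (x + v + s *\<^sub>R u) - D x - B (x + v + s *\<^sub>R u - x)) \<le> e * ?N"
        using D[of "x + v + s *\<^sub>R u"] mult_left_mono[OF n1 e] n1 uv by linarith
      moreover have "norm (D (x + s *\<^sub>R u) - D x - B (x + s *\<^sub>R u - x)) \<le> e * ?N"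
        using D[of "x + s *\<^sub>R u"] mult_left_mono[OF n2 e] n2 uv by linarith
      ultimately show "norm ((D (x + v + s *\<^sub>R u) - D x - B (x + v + s *\<^sub>R u - x))
          - (D (x + s *\<^sub>R u) - D x - B (x + s *\<^sub>R u - x))) \<le> e * ?N + e * ?N"
        by (rule order_trans[OF norm_triangle_ineq4 add_mono])
    qed (use e in auto)
    finally show "norm (D (x + v + s *\<^sub>R u) u - D (x + s *\<^sub>R u) u - B v u) \<le> 2 * e * ?N\<^sup>2"
      by (simp add: power2_eq_square algebra_simps)
  qed
  then show ?thesis by (simp add: algebra_simps)
qed

text \<open>The second difference of \<open>t u\<close> and \<open>t v\<close> lies within \<open>o(t\<^sup>2)\<close> of \<open>t\<^sup>2 B(u,v)\<close> and of \<open>t\<^sup>2 B(v,u)\<close>.\<close>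
lemma second_derivative_symmetric:
  fixes g :: "'a::real_normed_vector \<Rightarrow> 'b::real_normed_vector"
  assumes "has_second_derivative g B x"
  shows "B u v = B v u"
proof -
  obtain D where ev: "\<forall>\<^sub>F y in nhds x. (g has_derivative blinfun_apply (D y)) (at y)"
    and DB: "(D has_derivative blinfun_apply B) (at x)"
    using assms by (auto simp: has_second_derivative_def)
  obtain d0 where d0: "d0 > 0" "\<And>y. dist y x < d0 \<Longrightarrow> (g has_derivative blinfun_apply (D y)) (at y)"
    using ev by (auto simp: eventually_nhds_metric)
  have "norm (B u v - B v u) \<le> e * (4 * (norm u + norm v)\<^sup>2)" if e: "e > 0" for e
  proof -
    obtain d1 where d1: "d1 > 0"
      "\<And>y. norm (y - x) < d1 \<Longrightarrow> norm (D y - D x - B (y - x)) \<le> e * norm (y - x)"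
      using DB e unfolding has_derivative_at_alt by blast
    define \<delta> where "\<delta> = min d0 d1"
    \<comment> \<open>\<open>t\<close> scales both directions into the ball where \<open>D\<close> is \<open>e\<close>-close to its linearisation; the \<open>+ 1\<close>
      avoids a division by 0.\<close>
    define t where "t = \<delta> / (2 * (norm u + norm v + 1))"
    have pos: "norm u + norm v + 1 > 0" using norm_ge_zero[of u] norm_ge_zero[of v] by linarith
    have "\<delta> > 0" using d0 d1 by (simp add: \<delta>_def)
    then have t: "t > 0" using pos by (simp add: t_def)
    have "norm u + norm v < 2 * (norm u + norm v + 1)"
      using norm_ge_zero[of u] norm_ge_zero[of v] unfolding distrib_left by linarith
    then have "t * (norm u + norm v) < t * (2 * (norm u + norm v + 1))"
      using t by (rule mult_strict_left_mono)
    also have "\<dots> = \<delta>" using pos by (simp add: t_def)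
    finally have small: "t * (norm u + norm v) < \<delta>" .
    have gd: "(g has_derivative blinfun_apply (D y)) (at y)" if "norm (y - x) < \<delta>" for y
      using that d0 by (simp add: \<delta>_def dist_norm)
    have Dd: "norm (D y - D x - B (y - x)) \<le> e * norm (y - x)" if "norm (y - x) < \<delta>" for y
      using that d1 by (simp add: \<delta>_def)
    let ?\<Delta> = "g (x + t *\<^sub>R u + t *\<^sub>R v) - g (x + t *\<^sub>R u) - g (x + t *\<^sub>R v) + g x"
    have A: "norm (?\<Delta> - B (t *\<^sub>R v) (t *\<^sub>R u)) \<le> 2 * e * (t * (norm u + norm v))\<^sup>2"
      using second_difference_bound[of x \<delta> g D B e "t *\<^sub>R u" "t *\<^sub>R v"] gd Dd small e t
      by (simp add: algebra_simps)
    have C: "norm (?\<Delta> - B (t *\<^sub>R u) (t *\<^sub>R v)) \<le> 2 * e * (t * (norm u + norm v))\<^sup>2"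
      using second_difference_bound[of x \<delta> g D B e "t *\<^sub>R v" "t *\<^sub>R u"] gd Dd small e t
      by (simp add: algebra_simps)
    have "t\<^sup>2 *\<^sub>R (B u v - B v u) =
        (?\<Delta> - B (t *\<^sub>R v) (t *\<^sub>R u)) - (?\<Delta> - B (t *\<^sub>R u) (t *\<^sub>R v))"
      by (simp add: blinfun.bilinear_simps power2_eq_square algebra_simps)
    then have "t\<^sup>2 * norm (B u v - B v u) =
        norm ((?\<Delta> - B (t *\<^sub>R v) (t *\<^sub>R u)) - (?\<Delta> - B (t *\<^sub>R u) (t *\<^sub>R v)))"
      by (metis abs_of_nonneg norm_scaleR zero_le_power2)
    also have "\<dots> \<le> 2 * e * (t * (norm u + norm v))\<^sup>2 + 2 * e * (t * (norm u + norm v))\<^sup>2"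
      by (rule order_trans[OF norm_triangle_ineq4 add_mono[OF A C]])
    also have "\<dots> = t\<^sup>2 * (e * (4 * (norm u + norm v)\<^sup>2))"
      by (simp add: power_mult_distrib)
    finally show ?thesis using t by simp
  qed
  note bd = this
  define K where "K = 4 * (norm u + norm v)\<^sup>2 + 1"
  have "K > 0" by (simp add: K_def add_nonneg_pos)
  have "norm (B u v - B v u) \<le> 0 + e" if "e > 0" for e
  proof -
    have "norm (B u v - B v u) \<le> e / K * (4 * (norm u + norm v)\<^sup>2)"
      using bd[of "e / K"] that \<open>K > 0\<close> by simp
    also have "\<dots> \<le> e / K * K" using that \<open>K > 0\<close> by (intro mult_left_mono) (auto simp: K_def)
    finally show ?thesis using \<open>K > 0\<close> by simp
  qed
  then have "norm (B u v - B v u) \<le> 0" by (rule field_le_epsilon)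
  then show ?thesis by simp
qed

lemma has_second_derivative_unique:
  assumes "has_second_derivative g B x" "has_second_derivative g C x"
  shows "B = C"
proof -
  obtain D where D: "\<forall>\<^sub>F y in nhds x. (g has_derivative blinfun_apply (D y)) (at y)"
      "(D has_derivative blinfun_apply B) (at x)"
    using assms by (auto simp: has_second_derivative_def)
  obtain E where E: "\<forall>\<^sub>F y in nhds x. (g has_derivative blinfun_apply (E y)) (at y)"
      "(E has_derivative blinfun_apply C) (at x)"
    using assms by (auto simp: has_second_derivative_def)
  have ev: "\<forall>\<^sub>F y in nhds x. D y = E y"
    using D(1) E(1)
    by eventually_elim (auto dest: has_derivative_unique simp: blinfun_apply_inject)
  have "(E has_derivative blinfun_apply B) (at x)"
    using has_derivative_transform_eventually[OF D(2), of E] ev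
    by (auto simp: eventually_nhds_conv_at)
  with E(2) show ?thesis by (auto dest: has_derivative_unique simp: blinfun_apply_inject)
qed

lemma second_derivative_eqI:
  assumes "has_second_derivative g B x" shows "second_derivative g x = B"
  unfolding second_derivative_def using assms has_second_derivative_unique by blast

lemma has_second_derivative_transform_within_open:
  assumes "has_second_derivative g B x" "open N" "x \<in> N" "\<And>y. y \<in> N \<Longrightarrow> g y = g' y"
  shows "has_second_derivative g' B x"
proof -
  obtain D where D: "\<forall>\<^sub>F y in nhds x. (g has_derivative blinfun_apply (D y)) (at y)"
      "(D has_derivative blinfun_apply B) (at x)"
    using assms by (auto simp: has_second_derivative_def)
  have "\<forall>\<^sub>F y in nhds x. y \<in> N" using assms(2,3) by (rule eventually_nhds_in_open)
  with D(1) have "\<forall>\<^sub>F y in nhds x. (g' has_derivative blinfun_apply (D y)) (at y)"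
  proof eventually_elim
    case (elim y)
    show ?case by (rule has_derivative_transform_within_open[OF elim(1) assms(2) elim(2) assms(4)])
  qed
  with D(2) show ?thesis by (auto simp: has_second_derivative_def)
qed

text \<open>The second derivative of a composite, assembled from the first and second derivatives
  \<open>A\<close>, \<open>B\<close> of the outer and \<open>D\<close>, \<open>E\<close> of the inner map. It is built from the bounded linear maps
  \<open>X \<mapsto> X o\<^sub>L D\<close> and \<open>X \<mapsto> A o\<^sub>L X\<close>, so that its continuity in all four arguments is automatic.\<close>
definition chain2 ::
  "('b::real_normed_vector \<Rightarrow>\<^sub>L 'c::real_normed_vector) \<Rightarrow> ('b \<Rightarrow>\<^sub>L 'b \<Rightarrow>\<^sub>L 'c) \<Rightarrow>
   ('a::real_normed_vector \<Rightarrow>\<^sub>L 'b) \<Rightarrow> ('a \<Rightarrow>\<^sub>L 'a \<Rightarrow>\<^sub>L 'b) \<Rightarrow> 'a \<Rightarrow>\<^sub>L 'a \<Rightarrow>\<^sub>L 'c" where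
  "chain2 A B D E = (bounded_bilinear.prod_left (o\<^sub>L) D o\<^sub>L (B o\<^sub>L D))
     + (bounded_bilinear.prod_right (o\<^sub>L) A o\<^sub>L E)"

lemma chain2_apply1: "chain2 A B D E u = (B (D u) o\<^sub>L D) + (A o\<^sub>L E u)"
  by (simp add: chain2_def blinfun.bilinear_simps
      bounded_bilinear.prod_left.rep_eq[OF bounded_bilinear_blinfun_compose]
      bounded_bilinear.prod_right.rep_eq[OF bounded_bilinear_blinfun_compose])

lemma chain2_apply [simp]: "chain2 A B D E u v = B (D u) (D v) + A (E u v)"
  by (simp add: chain2_apply1 blinfun.bilinear_simps)

lemma continuous_on_chain2:
  assumes "continuous_on S A" "continuous_on S B" "continuous_on S D" "continuous_on S E"
  shows "continuous_on S (\<lambda>x. chain2 (A x) (B x) (D x) (E x))"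
  unfolding chain2_def
  by (intro continuous_intros assms bounded_bilinear.continuous_on[OF bounded_bilinear_blinfun_compose]
      bounded_linear.continuous_on[OF bounded_bilinear.bounded_linear_prod_left[OF bounded_bilinear_blinfun_compose]]
      bounded_linear.continuous_on[OF bounded_bilinear.bounded_linear_prod_right[OF bounded_bilinear_blinfun_compose]])

lemma has_derivative_chain_blinfun:
  assumes "(h has_derivative blinfun_apply D) (at x)"
    and "(g has_derivative blinfun_apply A) (at (h x))"
  shows "((g \<circ> h) has_derivative blinfun_apply (A o\<^sub>L D)) (at x)"
  using diff_chain_at[OF assms] by (simp add: blinfun_compose.rep_eq)

lemma has_derivative_chain2:
  assumes h: "(h has_derivative blinfun_apply (Dh x)) (at x)"
    and Dh: "(Dh has_derivative blinfun_apply E) (at x)"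
    and Dg: "(Dg has_derivative blinfun_apply B) (at (h x))"
  shows "((\<lambda>y. Dg (h y) o\<^sub>L Dh y) has_derivative blinfun_apply (chain2 (Dg (h x)) B (Dh x) E)) (at x)"
proof -
  have "((\<lambda>y. Dg (h y)) has_derivative (\<lambda>k. B (Dh x k))) (at x)"
    using has_derivative_compose[OF h Dg] .
  from bounded_bilinear.FDERIV[OF bounded_bilinear_blinfun_compose this Dh]
  show ?thesis by (simp add: chain2_apply1[abs_def] add.commute)
qed

text \<open>The pointwise form is needed besides the one on open sets: it is applied to maps that are twice
  differentiable at a single point.\<close>
lemma has_second_derivative_compose:
  assumes g1: "\<forall>\<^sub>F z in nhds (h x). (g has_derivative blinfun_apply (Dg z)) (at z)"
    and g2: "(Dg has_derivative blinfun_apply B) (at (h x))"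
    and h1: "(h has_derivative blinfun_apply D) (at x)"
    and h2: "has_second_derivative h E x"
  shows "has_second_derivative (g \<circ> h) (chain2 (Dg (h x)) B D E) x"
proof -
  obtain Dh where Dh: "\<forall>\<^sub>F y in nhds x. (h has_derivative blinfun_apply (Dh y)) (at y)"
      "(Dh has_derivative blinfun_apply E) (at x)"
    using h2 by (auto simp: has_second_derivative_def)
  have hx: "(h has_derivative blinfun_apply (Dh x)) (at x)"
    using Dh(1) by (rule eventually_nhds_x_imp_x)
  then have DhD: "Dh x = D"
    using has_derivative_unique[OF hx h1] by (simp add: blinfun_apply_inject)
  have "filterlim h (nhds (h x)) (nhds x)"
    using has_derivative_continuous[OF hx] by (simp add: continuous_at tendsto_at_iff_tendsto_nhds)
  then have "\<forall>\<^sub>F y in nhds x. (g has_derivative blinfun_apply (Dg (h y))) (at (h y))"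
    using g1 by (auto simp: filterlim_iff)
  with Dh(1) have "\<forall>\<^sub>F y in nhds x. ((g \<circ> h) has_derivative blinfun_apply (Dg (h y) o\<^sub>L Dh y)) (at y)"
    by eventually_elim (rule has_derivative_chain_blinfun)
  moreover have "((\<lambda>y. Dg (h y) o\<^sub>L Dh y) has_derivative
      blinfun_apply (chain2 (Dg (h x)) B D E)) (at x)"
    using has_derivative_chain2[of h Dh x E Dg B] hx Dh(2) g2 DhD by simp
  ultimately show ?thesis unfolding has_second_derivative_def
    by (intro exI[of _ "\<lambda>y. Dg (h y) o\<^sub>L Dh y"] conjI)
qed

text \<open>The derivatives are named, so that estimates can refer to them across a change of coordinates.\<close>
definition C2_derivs ::
  "'a::real_normed_vector set \<Rightarrow> ('a \<Rightarrow> 'b::real_normed_vector) \<Rightarrow> ('a \<Rightarrow> 'a \<Rightarrow>\<^sub>L 'b) \<Rightarrow>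
   ('a \<Rightarrow> 'a \<Rightarrow>\<^sub>L 'a \<Rightarrow>\<^sub>L 'b) \<Rightarrow> bool" where
  "C2_derivs S g D D2 \<longleftrightarrow>
     (\<forall>x\<in>S. (g has_derivative blinfun_apply (D x)) (at x)) \<and>
     (\<forall>x\<in>S. (D has_derivative blinfun_apply (D2 x)) (at x)) \<and> continuous_on S D2"

lemma C2_on_iff: "C2_on S g \<longleftrightarrow> (\<exists>D D2. C2_derivs S g D D2)"
  by (simp add: C2_on_def C2_derivs_def)

lemma C2_derivs_subset: "C2_derivs S g D D2 \<Longrightarrow> T \<subseteq> S \<Longrightarrow> C2_derivs T g D D2"
  by (auto simp: C2_derivs_def intro: continuous_on_subset)

lemma C2_derivs_cong:
  assumes "C2_derivs S g D D2" "open S" "\<And>x. x \<in> S \<Longrightarrow> g x = g' x"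
  shows "C2_derivs S g' D D2"
  using assms unfolding C2_derivs_def
  by (auto intro: has_derivative_transform_within_open)

lemma C2_derivs_compose:
  assumes g: "C2_derivs T g Dg D2g" and h: "C2_derivs S h Dh D2h" and "h ` S \<subseteq> T"
  shows "C2_derivs S (g \<circ> h) (\<lambda>x. Dg (h x) o\<^sub>L Dh x)
           (\<lambda>x. chain2 (Dg (h x)) (D2g (h x)) (Dh x) (D2h x))"
proof -
  have hc: "continuous_on S h" and Dhc: "continuous_on S Dh"
    using h unfolding C2_derivs_def
    by (meson continuous_at_imp_continuous_on has_derivative_continuous)+
  have Dgc: "continuous_on T Dg"
    using g unfolding C2_derivs_def
    by (meson continuous_at_imp_continuous_on has_derivative_continuous)
  have 1: "continuous_on S (\<lambda>x. Dg (h x))" "continuous_on S (\<lambda>x. D2g (h x))"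
    using g \<open>h ` S \<subseteq> T\<close>
    by (auto intro!: continuous_on_compose2[OF _ hc] Dgc simp: C2_derivs_def)
  show ?thesis
    unfolding C2_derivs_def
    using assms
    by (intro conjI ballI has_derivative_chain_blinfun has_derivative_chain2 continuous_on_chain2 1 Dhc)
       (auto simp: C2_derivs_def image_subset_iff)
qed

lemma C2_derivs_has_second_derivative:
  assumes "C2_derivs S g D D2" "open S" "x \<in> S"
  shows "has_second_derivative g (D2 x) x"
  using assms unfolding has_second_derivative_def C2_derivs_def
  by (auto intro!: exI[of _ D] simp: eventually_nhds)

text \<open>The continuity of the second derivative bounds it near \<open>x0\<close>, and the mean value inequality on
  a ball turns this into Lipschitz constants for \<open>D\<close> and for \<open>g\<close>.\<close>
lemma C2_derivs_local_bounds:
  assumes C2: "C2_derivs S g D D2" and "open S" and "x0 \<in> S"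
  obtains r M where "r > 0" "M > 0" "ball x0 r \<subseteq> S"
    "\<And>x. x \<in> ball x0 r \<Longrightarrow> norm (D2 x) \<le> M"
    "\<And>x. x \<in> ball x0 r \<Longrightarrow> norm (D x) \<le> M"
    "\<And>x y. x \<in> ball x0 r \<Longrightarrow> y \<in> ball x0 r \<Longrightarrow> norm (D x - D y) \<le> M * norm (x - y)"
    "\<And>x y. x \<in> ball x0 r \<Longrightarrow> y \<in> ball x0 r \<Longrightarrow> norm (g x - g y) \<le> M * norm (x - y)"
proof -
  obtain r0 where r0: "r0 > 0" "ball x0 r0 \<subseteq> S"
    using assms open_contains_ball by blast
  have "continuous_on S D"
    using C2 unfolding C2_derivs_def
    by (meson continuous_at_imp_continuous_on has_derivative_continuous)
  then have "isCont D x0" "isCont D2 x0"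
    using C2 assms unfolding C2_derivs_def by (metis continuous_on_eq_continuous_at)+
  then obtain s1 s2 where s: "s1 > 0" "s2 > 0" "\<And>x. dist x x0 < s1 \<Longrightarrow> dist (D x) (D x0) < 1"
    "\<And>x. dist x x0 < s2 \<Longrightarrow> dist (D2 x) (D2 x0) < 1"
    unfolding continuous_at_eps_delta by (metis zero_less_one)
  define r1 where "r1 = min s1 s2"
  have r1: "r1 > 0" "\<And>x. dist x x0 < r1 \<Longrightarrow> dist (D x) (D x0) < 1 \<and> dist (D2 x) (D2 x0) < 1"
    using s by (auto simp: r1_def)
  define r where "r = min r0 r1"
  define M where "M = norm (D x0) + norm (D2 x0) + 1"
  have b: "norm (D x) \<le> M" "norm (D2 x) \<le> M" if "x \<in> ball x0 r" for x
  proof -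
    have "dist x x0 < r1" using that by (simp add: r_def dist_commute)
    then have "norm (D x - D x0) < 1" "norm (D2 x - D2 x0) < 1" using r1 by (auto simp: dist_norm)
    then show "norm (D x) \<le> M" "norm (D2 x) \<le> M"
      using norm_triangle_ineq2[of "D x" "D x0"] norm_triangle_ineq2[of "D2 x" "D2 x0"]
        norm_ge_zero[of "D x0"] norm_ge_zero[of "D2 x0"]
      unfolding M_def by linarith+
  qed
  have sub: "ball x0 r \<subseteq> S" using r0 by (auto simp: r_def)
  show thesis
  proof
    show "r > 0" using r0 r1 by (simp add: r_def)
    show "M > 0" using norm_ge_zero[of "D x0"] norm_ge_zero[of "D2 x0"] unfolding M_def by linarith
    show "ball x0 r \<subseteq> S" by fact
    fix x y assume xy: "x \<in> ball x0 r" "y \<in> ball x0 r"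
    show "norm (D x - D y) \<le> M * norm (x - y)"
    proof (rule differentiable_bound[of "ball x0 r" D "\<lambda>x. blinfun_apply (D2 x)"])
      fix z assume z: "z \<in> ball x0 r"
      show "(D has_derivative blinfun_apply (D2 z)) (at z within ball x0 r)"
        using C2 sub z unfolding C2_derivs_def by (blast intro: has_derivative_at_withinI)
      show "onorm (blinfun_apply (D2 z)) \<le> M" using b(2)[OF z] by (simp add: norm_blinfun.rep_eq)
    qed (use xy in auto)
    show "norm (g x - g y) \<le> M * norm (x - y)"
    proof (rule differentiable_bound[of "ball x0 r" g "\<lambda>x. blinfun_apply (D x)"])
      fix z assume z: "z \<in> ball x0 r"
      show "(g has_derivative blinfun_apply (D z)) (at z within ball x0 r)"
        using C2 sub z unfolding C2_derivs_def by (blast intro: has_derivative_at_withinI)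
      show "onorm (blinfun_apply (D z)) \<le> M" using b(1)[OF z] by (simp add: norm_blinfun.rep_eq)
    qed (use xy in auto)
  qed (use b in auto)
qed

section \<open>The Newton step and its error\<close>

text \<open>Polarisation, \<open>4 B(a,b) = B(a+b,a+b) - B(a-b,a-b)\<close>. The norm of a second derivative that the
  conditions on \<open>\<phi>\<close> bound is the supremum on the diagonal; the Hessian of \<open>f \<circ> \<phi>\<^sub>p\<close> involves all of \<open>B\<close>.\<close>
lemma bilinear_bound_of_quadratic_bound:
  fixes B :: "'a::real_normed_vector \<Rightarrow>\<^sub>L 'a \<Rightarrow>\<^sub>L 'b::real_normed_vector"
  assumes sym: "\<And>u v. B u v = B v u"
    and q: "\<And>u. norm (B u u) \<le> \<alpha> * (norm u)\<^sup>2" and "\<alpha> \<ge> 0"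
  shows "norm (B u v) \<le> 2 * \<alpha> * norm u * norm v"
proof (cases "u = 0 \<or> v = 0")
  case True
  then show ?thesis by (auto simp: blinfun.bilinear_simps)
next
  case False
  have unit: "norm (B a b) \<le> 2 * \<alpha>" if "norm a = 1" "norm b = 1" for a b
  proof -
    have "4 *\<^sub>R B a b = (1 + 1 + 1 + 1) *\<^sub>R B a b" by simp
    also have "\<dots> = B (a + b) (a + b) - B (a - b) (a - b)"
      by (simp only: scaleR_left_distrib scaleR_one) (simp add: blinfun.bilinear_simps sym[of b a])
    finally have "4 * norm (B a b) = norm (B (a + b) (a + b) - B (a - b) (a - b))"
      by (metis abs_numeral norm_scaleR)
    also have "\<dots> \<le> \<alpha> * (norm (a + b))\<^sup>2 + \<alpha> * (norm (a - b))\<^sup>2"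
      by (rule order_trans[OF norm_triangle_ineq4 add_mono[OF q q]])
    also have "\<dots> \<le> \<alpha> * 2\<^sup>2 + \<alpha> * 2\<^sup>2"
      using norm_triangle_ineq[of a b] norm_triangle_ineq4[of a b] that \<open>\<alpha> \<ge> 0\<close>
      by (intro add_mono mult_left_mono power_mono) auto
    finally show ?thesis by simp
  qed
  have "norm (B (u /\<^sub>R norm u) (v /\<^sub>R norm v)) \<le> 2 * \<alpha>"
    using False by (intro unit) auto
  then show ?thesis
    using False by (simp add: blinfun.bilinear_simps field_simps)
qed

lemma quadratic_bound_of_second_derivative_norm:
  fixes B :: "'a::real_normed_vector \<Rightarrow>\<^sub>L 'a \<Rightarrow>\<^sub>L 'b::real_normed_vector"
  assumes "second_derivative_norm B \<le> \<alpha>"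
  shows "norm (B u u) \<le> \<alpha> * (norm u)\<^sup>2"
proof (cases "u = 0")
  case True
  then show ?thesis by (simp add: blinfun.bilinear_simps)
next
  case False
  have bdd: "bdd_above ((\<lambda>\<eta>. norm (B \<eta> \<eta>)) ` sphere 0 1)"
  proof (rule bdd_aboveI2)
    fix \<eta> :: 'a assume "\<eta> \<in> sphere 0 1"
    then show "norm (B \<eta> \<eta>) \<le> norm B"
      using order_trans[OF norm_blinfun[of "B \<eta>" \<eta>] mult_right_mono[OF norm_blinfun[of B \<eta>]]]
      by simp
  qed
  have "norm (B (u /\<^sub>R norm u) (u /\<^sub>R norm u)) \<le> second_derivative_norm B"
    unfolding second_derivative_norm_def using False by (intro cSUP_upper bdd) auto
  then have "norm (B (u /\<^sub>R norm u) (u /\<^sub>R norm u)) \<le> \<alpha>" using assms by linarith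
  then show ?thesis
    using False by (simp add: blinfun.bilinear_simps field_simps power2_eq_square)
qed

lemma linear_eq_inner_axis:
  fixes l :: "(real^'n) \<Rightarrow>\<^sub>L real"
  shows "l v = v \<bullet> (\<chi> i. l (axis i 1))"
proof -
  have "l v = l (\<Sum>i\<in>UNIV. v $ i *\<^sub>R axis i 1)"
    using basis_expansion[of v] by (simp add: scalar_mult_eq_scaleR)
  also have "\<dots> = v \<bullet> (\<chi> i. l (axis i 1))"
    by (simp add: blinfun.sum_right blinfun.scaleR_right inner_vec_def)
  finally show ?thesis .
qed

lemma gradient_inner:
  assumes "(g has_derivative blinfun_apply g') (at x)"
  shows "v \<bullet> gradient g x = g' v"
proof -
  have "GDERIV g x :> (\<chi> i. g' (axis i 1))"
    unfolding gderiv_def using assms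
    unfolding linear_eq_inner_axis[of g', symmetric] .
  then have "gradient g x = (\<chi> i. g' (axis i 1))"
    unfolding gradient_def 
  proof (rule the_equality)
    fix d assume "GDERIV g x :> d"
    then have "(\<lambda>h. h \<bullet> d) = (\<lambda>h. h \<bullet> (\<chi> i. g' (axis i 1)))"
      using \<open>GDERIV g x :> (\<chi> i. g' (axis i 1))\<close> unfolding gderiv_def
      by (rule has_derivative_unique)
    then show "d = (\<chi> i. g' (axis i 1))"
      by (metis vector_eq_ldot)
  qed
  then show ?thesis by (simp only: linear_eq_inner_axis[of g' v])
qed

lemma hessian_inner:
  assumes "has_second_derivative g B x"
  shows "v \<bullet> (hessian g x *v u) = B v u"
proof -
  have row: "hessian g x $ i = (\<chi> j. B (axis i 1) (axis j 1))" for i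
    unfolding hessian_def second_derivative_eqI[OF assms] by simp
  have "(hessian g x *v u) $ i = B (axis i 1) u" for i
    unfolding matrix_vector_mul_component row linear_eq_inner_axis[of "B (axis i 1)" u]
    by (rule inner_commute)
  then have "hessian g x *v u = (\<chi> i. B (axis i 1) u)" by (simp add: vec_eq_iff)
  moreover have "B v u = B u v" by (rule second_derivative_symmetric[OF assms])
  moreover have "B (axis i 1) u = B u (axis i 1)" for i
    by (rule second_derivative_symmetric[OF assms])
  ultimately show ?thesis by (simp only: linear_eq_inner_axis[of "B u" v])
qed

text \<open>The Newton step in the form of a variational equation. It refers neither to coordinates nor
  to the inner product, so it can be transported through linear isomorphisms.\<close>
lemma newton_variational:
  assumes g': "(g has_derivative blinfun_apply g') (at x)"
    and B: "has_second_derivative g B x"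
    and nondeg: "\<And>u. (\<And>v. B u v = 0) \<Longrightarrow> u = 0"
  shows "\<exists>y. newton g x = Some y \<and> (\<forall>v. B (y - x) v = - g' v)"
proof -
  let ?H = "hessian g x"
  have "u = 0" if "?H *v u = 0" for u
  proof (rule nondeg)
    fix v show "B u v = 0"
      using hessian_inner[OF B, of v u] that second_derivative_symmetric[OF B, of u v] by simp
  qed
  then have inv: "invertible ?H"
    using matrix_left_invertible_ker invertible_left_inverse by blast
  have "?H ** matrix_inv ?H = mat 1"
    using inv someI_ex[of "\<lambda>A'. ?H ** A' = mat 1 \<and> A' ** ?H = mat 1"]
    by (simp add: invertible_def matrix_inv_def)
  moreover define d where "d = matrix_inv ?H *v gradient g x"
  ultimately have "?H *v d = gradient g x"
    by (simp add: matrix_vector_mul_assoc)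
  then have "B (- d) v = - g' v" for v
    using hessian_inner[OF B, of v d] gradient_inner[OF g', of v] second_derivative_symmetric[OF B, of d v]
    by (simp add: blinfun.bilinear_simps)
  moreover have "newton g x = Some (x - d)"
    using inv B by (auto simp: newton_def d_def)
  ultimately show ?thesis by (intro exI[of _ "x - d"]) simp
qed

text \<open>Multiplying by the Hessian matrix fills the second argument of the second derivative; symmetry moves
  the vector to the first one, where a bound on the matrix becomes a bound in the dual space.\<close>
lemma hessian_condition_bilinear:
  assumes Bx: "has_second_derivative g Bx x" and B0: "has_second_derivative g B0 0"
    and le: "norm ((hessian g x - hessian g 0) *v z) \<le> K"
  shows "norm ((Bx - B0) z) \<le> K"
proof (rule norm_blinfun_bound)
  show "K \<ge> 0" using le norm_ge_zero order_trans by blast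
  fix v
  have "(Bx - B0) z v = v \<bullet> ((hessian g x - hessian g 0) *v z)"
    using second_derivative_symmetric[OF Bx, of z v] second_derivative_symmetric[OF B0, of z v]
    by (simp add: blinfun.bilinear_simps matrix_vector_mult_diff_rdistrib inner_diff_right
        hessian_inner[OF Bx] hessian_inner[OF B0])
  also have "norm \<dots> \<le> norm v * norm ((hessian g x - hessian g 0) *v z)"
    by (simp add: Cauchy_Schwarz_ineq2)
  also have "\<dots> \<le> K * norm v" using mult_left_mono[OF le norm_ge_zero[of v]] by (simp add: mult.commute)
  finally show "norm ((Bx - B0) z v) \<le> K * norm v" .
qed

text \<open>In one coordinate system the hypothesis on the Hessian gives the order condition
  \<open>D\<^sup>2g(x) x - Dg(x) = O(\<parallel>x\<parallel>\<^sup>2)\<close>: along the ray through \<open>x\<close> the derivative of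
  \<open>s \<mapsto> Dg(s x) - s D\<^sup>2g(0) x\<close> is \<open>(D\<^sup>2g(s x) - D\<^sup>2g(0)) x\<close>, and the hypothesis
  at the point \<open>s x\<close> bounds it after division by \<open>s\<close>.\<close>
lemma order_condition_of_hessian_condition:
  fixes D :: "'a::real_normed_vector \<Rightarrow> 'a \<Rightarrow>\<^sub>L 'b::real_normed_vector"
  assumes g: "C2_derivs S g D D2" and S: "ball 0 r \<subseteq> S" and D0: "D 0 = 0"
    and h: "\<And>x. x \<in> ball 0 r \<Longrightarrow> norm ((D2 x - D2 0) x) \<le> \<eta> * (norm x)\<^sup>2"
    and "\<eta> \<ge> 0" and x: "x \<in> ball 0 r"
  shows "norm (D2 x x - D x) \<le> 2 * \<eta> * (norm x)\<^sup>2"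
proof -
  let ?F = "\<lambda>s::real. D (0 + s *\<^sub>R x) - s *\<^sub>R D2 0 x"
  have "norm (?F 1 - ?F 0) \<le> \<eta> * (norm x)\<^sup>2"
  proof (rule norm_increment_le)
    fix s :: real assume s: "s \<in> {0..1}"
    have "norm (s *\<^sub>R x) \<le> norm x" using s by (simp add: mult_left_le_one_le)
    then have sx: "s *\<^sub>R x \<in> ball 0 r" using x by simp
    have "(D has_derivative blinfun_apply (D2 (0 + s *\<^sub>R x))) (at (0 + s *\<^sub>R x))"
      using g subsetD[OF S sx] by (simp add: C2_derivs_def)
    then show "(?F has_vector_derivative (D2 (0 + s *\<^sub>R x) x - D2 0 x)) (at s)"
      by (intro has_vector_derivative_diff has_derivative_line)
         (auto intro!: derivative_eq_intros simp: has_vector_derivative_def)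
    show "norm (D2 (0 + s *\<^sub>R x) x - D2 0 x) \<le> \<eta> * (norm x)\<^sup>2"
    proof (cases "s = 0")
      case True
      then show ?thesis using \<open>\<eta> \<ge> 0\<close> by simp
    next
      case False
      then have "s > 0" using s by simp
      have "s * norm ((D2 (s *\<^sub>R x) - D2 0) x) = norm ((D2 (s *\<^sub>R x) - D2 0) (s *\<^sub>R x))"
        using \<open>s > 0\<close> by (simp add: blinfun.scaleR_right)
      also have "\<dots> \<le> s * (s * (\<eta> * (norm x)\<^sup>2))"
        using h[OF sx] by (simp add: power_mult_distrib power2_eq_square algebra_simps)
      finally have "norm ((D2 (s *\<^sub>R x) - D2 0) x) \<le> s * (\<eta> * (norm x)\<^sup>2)"
        using \<open>s > 0\<close> by simp
      also have "\<dots> \<le> \<eta> * (norm x)\<^sup>2"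
        using s \<open>\<eta> \<ge> 0\<close> by (intro mult_left_le_one_le) auto
      finally show ?thesis by (simp add: blinfun.diff_left)
    qed
  qed
  then have "norm (D x - D2 0 x) \<le> \<eta> * (norm x)\<^sup>2" by (simp add: D0)
  moreover have "D2 x x - D x = (D2 x - D2 0) x - (D x - D2 0 x)"
    by (simp add: blinfun.diff_left)
  ultimately have "norm (D2 x x - D x) \<le> \<eta> * (norm x)\<^sup>2 + \<eta> * (norm x)\<^sup>2"
    using order_trans[OF norm_triangle_ineq4 add_mono[OF h[OF x]]] by metis
  then show ?thesis by simp
qed

text \<open>The order condition at a critical point does not depend on the coordinates. By the chain rule
  the defect of \<open>g \<circ> h\<close> at \<open>x\<close> is the defect of \<open>g\<close> at \<open>h(x)\<close> applied to \<open>Dh(x)v\<close>, plus a term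
  with \<open>Dh(x)x - h(x) = O(\<parallel>x\<parallel>\<^sup>2)\<close> and a term with \<open>Dg(h(x)) D\<^sup>2h(x)(x,v)\<close>, where \<open>Dg(h(x)) = O(\<parallel>x\<parallel>)\<close>.\<close>
lemma order_condition_compose:
  assumes g: "C2_derivs T g Dg D2g" "open T" and h: "C2_derivs S h Dh D2h" "open S"
    and "h ` S \<subseteq> T" "(0::'a::real_normed_vector) \<in> S" "h 0 = 0" "Dg 0 = 0"
    and oc: "\<And>z. z \<in> ball 0 r \<Longrightarrow> norm (D2g z z - Dg z) \<le> C * (norm z)\<^sup>2" and "r > 0" "C \<ge> 0"
  obtains s C' where "s > 0" "C' \<ge> 0"
    "\<And>x. x \<in> ball 0 s \<Longrightarrow>
      norm (chain2 (Dg (h x)) (D2g (h x)) (Dh x) (D2h x) x - (Dg (h x) o\<^sub>L Dh x)) \<le> C' * (norm x)\<^sup>2"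
proof -
  have T0: "0 \<in> T" using assms by force
  obtain r1 M where M: "r1 > 0" "M > 0"
    "\<And>x. x \<in> ball 0 r1 \<Longrightarrow> norm (D2g x) \<le> M"
    "\<And>x y. x \<in> ball 0 r1 \<Longrightarrow> y \<in> ball 0 r1 \<Longrightarrow> norm (Dg x - Dg y) \<le> M * norm (x - y)"
    using C2_derivs_local_bounds[OF g T0] by metis
  obtain r2 N where N: "r2 > 0" "N > 0" "ball 0 r2 \<subseteq> S"
    "\<And>x. x \<in> ball 0 r2 \<Longrightarrow> norm (D2h x) \<le> N"
    "\<And>x. x \<in> ball 0 r2 \<Longrightarrow> norm (Dh x) \<le> N"
    "\<And>x y. x \<in> ball 0 r2 \<Longrightarrow> y \<in> ball 0 r2 \<Longrightarrow> norm (Dh x - Dh y) \<le> N * norm (x - y)"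
    "\<And>x y. x \<in> ball 0 r2 \<Longrightarrow> y \<in> ball 0 r2 \<Longrightarrow> norm (h x - h y) \<le> N * norm (x - y)"
    using C2_derivs_local_bounds[OF h \<open>0 \<in> S\<close>] by metis
  define s where "s = min r2 (min r r1 / N)"
  have s: "s > 0" using N M \<open>r > 0\<close> by (simp add: s_def)
  define C' where "C' = C * N\<^sup>2 * N + M * N * N + M * N * N"
  have C': "C' \<ge> 0" using \<open>C \<ge> 0\<close> M N by (simp add: C'_def)
  show thesis
  proof (rule that[OF s C'])
    fix x assume x: "x \<in> ball (0::'a) s"
    have x2: "x \<in> ball 0 r2" using x by (simp add: s_def)
    have z: "norm (h x) \<le> N * norm x"
      using N(7)[OF x2, of 0] \<open>h 0 = 0\<close> N(1) by simp
    have "N * norm x < min r r1" using x N by (simp add: s_def field_simps)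
    then have zr: "h x \<in> ball 0 r" "h x \<in> ball 0 r1" using z by auto
    have Dgz: "norm (Dg (h x)) \<le> M * (N * norm x)"
      using order_trans[OF M(4)[OF zr(2), of 0] mult_left_mono[of "norm (h x - 0)" "N * norm x" M]]
        z M(1,2) \<open>Dg 0 = 0\<close> by simp
    have lin: "norm (Dh x x - h x) \<le> N * (norm x)\<^sup>2"
    proof -
      let ?F = "\<lambda>t::real. t *\<^sub>R Dh x x - h (0 + t *\<^sub>R x)"
      have "norm (?F 1 - ?F 0) \<le> N * (norm x)\<^sup>2"
      proof (rule norm_increment_le)
        fix t :: real assume t: "t \<in> {0..1}"
        have "norm (t *\<^sub>R x) \<le> norm x" using t by (simp add: mult_left_le_one_le)
        then have tx: "t *\<^sub>R x \<in> ball 0 r2" using x2 by simp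
        have "(h has_derivative blinfun_apply (Dh (0 + t *\<^sub>R x))) (at (0 + t *\<^sub>R x))"
          using h subsetD[OF N(3) tx] by (simp add: C2_derivs_def)
        then show "(?F has_vector_derivative (Dh x x - Dh (0 + t *\<^sub>R x) x)) (at t)"
          by (intro has_vector_derivative_diff has_derivative_line)
             (auto intro!: derivative_eq_intros simp: has_vector_derivative_def)
        have "norm (x - t *\<^sub>R x) = \<bar>1 - t\<bar> * norm x"
          by (metis norm_scaleR scaleR_left_diff_distrib scaleR_one)
        also have "\<dots> \<le> norm x" using t by (intro mult_left_le_one_le) auto
        finally have "norm (x - t *\<^sub>R x) \<le> norm x" .
        then have "norm (Dh x - Dh (t *\<^sub>R x)) \<le> N * norm x"
          using N(6)[OF x2 tx] mult_left_mono[of "norm (x - t *\<^sub>R x)" "norm x" N] N(2) by linarith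
        then have "norm ((Dh x - Dh (t *\<^sub>R x)) x) \<le> N * norm x * norm x"
          by (intro order_trans[OF norm_blinfun] mult_right_mono) auto
        then show "norm (Dh x x - Dh (0 + t *\<^sub>R x) x) \<le> N * (norm x)\<^sup>2"
          by (simp add: blinfun.diff_left power2_eq_square mult.assoc)
      qed
      then show ?thesis by (simp add: \<open>h 0 = 0\<close>)
    qed
    show "norm (chain2 (Dg (h x)) (D2g (h x)) (Dh x) (D2h x) x - (Dg (h x) o\<^sub>L Dh x)) \<le> C' * (norm x)\<^sup>2"
    proof (rule norm_blinfun_bound)
      show "0 \<le> C' * (norm x)\<^sup>2" using C' by simp
      fix v
      have w: "norm (Dh x v) \<le> N * norm v"
        by (intro order_trans[OF norm_blinfun] mult_right_mono N x2) auto
      have "(chain2 (Dg (h x)) (D2g (h x)) (Dh x) (D2h x) x - (Dg (h x) o\<^sub>L Dh x)) v =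
        (D2g (h x) (h x) - Dg (h x)) (Dh x v) + D2g (h x) (Dh x x - h x) (Dh x v)
         + Dg (h x) (D2h x x v)"
        by (simp add: blinfun.bilinear_simps)
      moreover have "norm ((D2g (h x) (h x) - Dg (h x)) (Dh x v)) \<le> C * N\<^sup>2 * N * (norm x)\<^sup>2 * norm v"
      proof -
        have "norm ((D2g (h x) (h x) - Dg (h x)) (Dh x v)) \<le> (C * (N * norm x)\<^sup>2) * (N * norm v)"
          using z \<open>C \<ge> 0\<close> N(2)
          by (intro order_trans[OF norm_blinfun] mult_mono w order_trans[OF oc[OF zr(1)]]
              mult_left_mono power_mono) auto
        then show ?thesis by (simp add: power_mult_distrib algebra_simps)
      qed
      moreover have "norm (D2g (h x) (Dh x x - h x) (Dh x v)) \<le> M * N * N * (norm x)\<^sup>2 * norm v"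
      proof -
        have "norm (D2g (h x) (Dh x x - h x)) \<le> M * (N * (norm x)\<^sup>2)"
          using M(2) by (intro order_trans[OF norm_blinfun] mult_mono lin M(3) zr) auto
        then have "norm (D2g (h x) (Dh x x - h x) (Dh x v)) \<le> (M * (N * (norm x)\<^sup>2)) * (N * norm v)"
          using M(2) N(2) by (intro order_trans[OF norm_blinfun mult_mono[OF _ w]]) auto
        then show ?thesis by (simp add: algebra_simps)
      qed
      moreover have "norm (Dg (h x) (D2h x x v)) \<le> M * N * N * (norm x)\<^sup>2 * norm v"
      proof -
        have "norm (D2h x x v) \<le> N * norm x * norm v"
          using N(2) by (intro order_trans[OF norm_blinfun] mult_right_mono N x2) auto
        then have "norm (Dg (h x) (D2h x x v)) \<le> (M * (N * norm x)) * (N * norm x * norm v)"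
          using M(2) N(2) by (intro order_trans[OF norm_blinfun mult_mono[OF Dgz]]) auto
        then show ?thesis by (simp add: algebra_simps power2_eq_square)
      qed
      ultimately show "norm ((chain2 (Dg (h x)) (D2g (h x)) (Dh x) (D2h x) x - (Dg (h x) o\<^sub>L Dh x)) v)
          \<le> C' * (norm x)\<^sup>2 * norm v"
        unfolding C'_def distrib_right
        by (metis (no_types, lifting) norm_triangle_mono)
    qed
  qed
qed

lemma nondegenerate_bounded_below:
  fixes B :: "(real^'n) \<Rightarrow>\<^sub>L (real^'n) \<Rightarrow>\<^sub>L real"
  assumes "\<And>u. (\<And>v. B u v = 0) \<Longrightarrow> u = 0"
  obtains m where "m > 0" "\<And>u. m * norm u \<le> norm (B u)"
proof -
  let ?L = "\<lambda>u. \<chi> j. B u (axis j 1)"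
  have lin: "linear ?L"
    by (rule linearI) (auto simp: vec_eq_iff blinfun.bilinear_simps)
  have "u = 0" if "?L u = 0" for u
  proof (rule assms)
    fix v show "B u v = 0" using linear_eq_inner_axis[of "B u" v] that by simp
  qed
  then have "inj ?L" using linear_injective_0[OF lin] by blast
  then obtain b where b: "b > 0" "\<And>u. b * norm u \<le> norm (?L u)"
    using linear_inj_bounded_below_pos[OF lin] by blast
  have le: "norm (?L u) \<le> real CARD('n) * norm (B u)" for u
  proof -
    have "norm (?L u) \<le> (\<Sum>j\<in>UNIV. \<bar>?L u $ j\<bar>)" by (rule norm_le_l1_cart)
    also have "\<dots> \<le> (\<Sum>j\<in>(UNIV::'n set). norm (B u))"
    proof (rule sum_mono)
      fix j :: 'n
      show "\<bar>?L u $ j\<bar> \<le> norm (B u)" using norm_blinfun[of "B u" "axis j 1"] by simp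
    qed
    finally show ?thesis by simp
  qed
  show thesis
  proof
    show "b / real CARD('n) > 0" using b by simp
    fix u
    show "b / real CARD('n) * norm u \<le> norm (B u)"
      using order_trans[OF b(2) le, of u] by (simp add: field_simps)
  qed
qed

text \<open>The quantitative core, for the perturbed Hessian \<open>A = D\<^sup>2f(x) + Df(x)\<circ>E\<close> with bounded \<open>E\<close>.
  Since \<open>D\<^sup>2f\<close> is continuous and \<open>Df(x) = O(\<parallel>x\<parallel>)\<close>, \<open>A\<close> is close to \<open>D\<^sup>2f(0)\<close>, hence bounded below by a constant near the
  critical point. If \<open>y\<close> is the Newton step, then \<open>A(x + y) = D\<^sup>2f(x) x - Df(x) + Df(x)\<circ>E(x)\<close>, where both
  the order condition and \<open>Df(x) = O(\<parallel>x\<parallel>)\<close> give \<open>O(\<parallel>x\<parallel>\<^sup>2)\<close>.\<close>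
lemma perturbed_newton_step_estimate:
  fixes f :: "real^'n \<Rightarrow> real"
  assumes f: "C2_derivs S f D D2" "open S" "0 \<in> S" and D0: "D 0 = 0"
    and nondeg: "\<And>u. (\<And>v. D2 0 u v = 0) \<Longrightarrow> u = 0"
    and oc: "\<And>x. x \<in> ball 0 r \<Longrightarrow> norm (D2 x x - D x) \<le> C * (norm x)\<^sup>2" and r: "r > 0" "C \<ge> 0"
    and \<alpha>: "\<alpha> \<ge> 0"
  obtains s K where "s > 0" "K \<ge> 0" "ball 0 s \<subseteq> S"
    "\<And>x E. x \<in> ball 0 s \<Longrightarrow> \<forall>u v. norm (blinfun_apply (blinfun_apply E u) v) \<le> \<alpha> * norm u * norm v \<Longrightarrow>
       (\<forall>u. (\<forall>v. chain2 (D x) (D2 x) id_blinfun E u v = 0) \<longrightarrow> u = 0) \<and>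
       (\<forall>y. (\<forall>v. chain2 (D x) (D2 x) id_blinfun E y v = - D x v) \<longrightarrow> norm (x + y) \<le> K * (norm x)\<^sup>2)"
proof -
  obtain m where m: "m > 0" "\<And>u. m * norm u \<le> norm (D2 0 u)"
    using nondegenerate_bounded_below[of "D2 0"] nondeg by blast
  obtain r1 M where M: "r1 > 0" "M > 0" "ball 0 r1 \<subseteq> S"
    "\<And>x y. x \<in> ball 0 r1 \<Longrightarrow> y \<in> ball 0 r1 \<Longrightarrow> norm (D x - D y) \<le> M * norm (x - y)"
    using C2_derivs_local_bounds[OF f] by metis
  have "isCont D2 0"
    using f unfolding C2_derivs_def by (metis continuous_on_eq_continuous_at)
  then obtain r2 where r2: "r2 > 0" "\<And>x. dist x 0 < r2 \<Longrightarrow> dist (D2 x) (D2 0) < m / 4"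
    using m(1) unfolding continuous_at_eps_delta by (metis divide_pos_pos zero_less_numeral)
  define s where "s = min r (min r1 (min r2 (m / (4 * M * (\<alpha> + 1)))))"
  define K where "K = 2 / m * (C + M * \<alpha>)"
  have pos: "4 * M * (\<alpha> + 1) > 0" using M \<alpha> by simp
  have s: "s > 0" using r M r2 m pos by (simp add: s_def)
  have K: "K \<ge> 0" using m r M \<alpha> by (simp add: K_def)
  have sub: "ball 0 s \<subseteq> S" using M(3) by (auto simp: s_def)
  have Dx: "norm (D x) \<le> M * norm x" if "x \<in> ball 0 s" for x
    using M(4)[of x 0] that M(1) D0 by (simp add: s_def)
  have below: "m / 2 * norm u \<le> norm (chain2 (D x) (D2 x) id_blinfun E u)"
    if x: "x \<in> ball 0 s" and E: "\<forall>u v. norm (E u v) \<le> \<alpha> * norm u * norm v"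
    for x u :: "real^'n" and E :: "(real^'n) \<Rightarrow>\<^sub>L (real^'n) \<Rightarrow>\<^sub>L (real^'n)"
  proof -
    let ?A = "chain2 (D x) (D2 x) id_blinfun E"
    have "norm (?A u - D2 0 u) \<le> m / 2 * norm u"
    proof (rule norm_blinfun_bound)
      show "0 \<le> m / 2 * norm u" using m by simp
      fix v
      have 1: "norm ((D2 x - D2 0) u v) \<le> m / 4 * norm u * norm v"
      proof -
        have "norm (D2 x - D2 0) \<le> m / 4" using r2(2)[of x] x by (simp add: s_def dist_norm)
        then have "norm ((D2 x - D2 0) u) \<le> m / 4 * norm u"
          by (intro order_trans[OF norm_blinfun] mult_right_mono) auto
        then show ?thesis by (rule order_trans[OF norm_blinfun mult_right_mono]) auto
      qed
      have "norm x * (4 * M * (\<alpha> + 1)) \<le> m"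
        using x pos by (simp add: s_def pos_less_divide_eq less_imp_le)
      moreover have "0 \<le> 4 * (M * norm x)" using M(2) by simp
      ultimately have "M * norm x * \<alpha> \<le> m / 4"
        unfolding distrib_left by (simp add: mult.commute mult.left_commute)
      then have 2: "norm (D x (E u v)) \<le> m / 4 * norm u * norm v"
      proof -
        have "norm (D x (E u v)) \<le> (M * norm x) * (\<alpha> * norm u * norm v)"
          using M(2) by (intro order_trans[OF norm_blinfun] mult_mono Dx x E[rule_format]) auto
        also have "\<dots> = (M * norm x * \<alpha>) * (norm u * norm v)" by simp
        also have "\<dots> \<le> m / 4 * (norm u * norm v)"
          by (intro mult_right_mono) (use \<open>M * norm x * \<alpha> \<le> m / 4\<close> in auto)
        finally show ?thesis by simp
      qed
      have "(?A u - D2 0 u) v = (D2 x - D2 0) u v + D x (E u v)"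
        by (simp add: blinfun.bilinear_simps)
      then show "norm ((?A u - D2 0 u) v) \<le> m / 2 * norm u * norm v"
        using norm_triangle_mono[OF 1 2] by simp
    qed
    then show ?thesis
      using m(2)[of u] norm_triangle_ineq2[of "D2 0 u" "?A u"]
      by (simp add: norm_minus_commute)
  qed
  show thesis
  proof (rule that[OF s K sub])
    fix x :: "real^'n" and E :: "(real^'n) \<Rightarrow>\<^sub>L (real^'n) \<Rightarrow>\<^sub>L (real^'n)"
    assume x: "x \<in> ball 0 s" and E: "\<forall>u v. norm (E u v) \<le> \<alpha> * norm u * norm v"
    let ?A = "chain2 (D x) (D2 x) id_blinfun E"
    have "u = 0" if "\<forall>v. ?A u v = 0" for u
    proof -
      have "?A u = 0" by (rule blinfun_eqI) (use that in \<open>simp only: zero_blinfun.rep_eq\<close>)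
      then have "m / 2 * norm u \<le> 0" using below[OF x E, of u] by simp
      then show "u = 0" using m by (simp add: mult_le_0_iff)
    qed
    moreover have "norm (x + y) \<le> K * (norm x)\<^sup>2" if y: "\<forall>v. ?A y v = - D x v" for y
    proof -
      have "norm (?A (x + y)) \<le> (C + M * \<alpha>) * (norm x)\<^sup>2"
      proof (rule norm_blinfun_bound)
        show "0 \<le> (C + M * \<alpha>) * (norm x)\<^sup>2" using r M \<alpha> by simp
        fix v
        have 1: "norm ((D2 x x - D x) v) \<le> C * (norm x)\<^sup>2 * norm v"
          using x by (intro order_trans[OF norm_blinfun] mult_right_mono oc) (auto simp: s_def)
        have 2: "norm (D x (E x v)) \<le> (M * norm x) * (\<alpha> * norm x * norm v)"
          using M(2) by (intro order_trans[OF norm_blinfun] mult_mono Dx x E[rule_format]) auto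
        have "?A (x + y) v = ?A x v + ?A y v" by (simp only: blinfun.add_right blinfun.add_left)
        then have "?A (x + y) v = (D2 x x - D x) v + D x (E x v)"
          using y by (simp add: blinfun.bilinear_simps)
        then show "norm (?A (x + y) v) \<le> (C + M * \<alpha>) * (norm x)\<^sup>2 * norm v"
          using norm_triangle_mono[OF 1 2] by (simp add: algebra_simps power2_eq_square)
      qed
      with below[OF x E, of "x + y"]
      have "m / 2 * norm (x + y) \<le> (C + M * \<alpha>) * (norm x)\<^sup>2" by linarith
      then show ?thesis
        using m(1) by (simp add: K_def field_simps)
    qed
    ultimately show "(\<forall>u. (\<forall>v. ?A u v = 0) \<longrightarrow> u = 0) \<and>
       (\<forall>y. (\<forall>v. ?A y v = - D x v) \<longrightarrow> norm (x + y) \<le> K * (norm x)\<^sup>2)" by blast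
  qed
qed

section \<open>Changes of coordinates\<close>

lemma chart_inv_left [simp]: "chart c \<Longrightarrow> p \<in> fst c \<Longrightarrow> chart_inv c (snd c p) = p"
  by (auto simp: chart_def homeomorphism_def)

lemma chart_inv_into: "x \<in> snd c ` fst c \<Longrightarrow> chart_inv c x \<in> fst c"
  by (rule inv_into_into)

lemma chart_inv_right: "x \<in> snd c ` fst c \<Longrightarrow> snd c (chart_inv c x) = x"
  by (rule f_inv_into_f)

lemma open_chart_image:
  assumes "chart c" "open V" "V \<subseteq> fst c"
  shows "open (snd c ` V)"
proof -
  have "openin (top_of_set (snd c ` fst c)) (snd c ` V)"
    using assms by (auto simp: chart_def intro!: homeomorphism_imp_open_map open_openin_trans)
  then show ?thesis using assms by (auto simp: chart_def intro: openin_open_trans)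
qed

lemma manifold_atlas_chart:
  assumes "C2_manifold \<A>"
  obtains d where "d \<in> \<A>" "chart d" "p \<in> fst d"
  using assms unfolding C2_manifold_def by blast

text \<open>Charts of the maximal atlas are only known to be compatible with the charts of \<open>\<A>\<close>, so the
  transition is factored locally through a chart of \<open>\<A>\<close> around the point.\<close>
lemma transition_C2_derivs:
  assumes mfd: "C2_manifold \<A>" and c: "C2_chart \<A> c" and e: "C2_chart \<A> e"
    and p: "p \<in> fst c" "p \<in> fst e"
  obtains W D D2 where "open W" "snd c p \<in> W" "W \<subseteq> snd c ` (fst c \<inter> fst e)"
    "C2_derivs W (snd e \<circ> chart_inv c) D D2"
proof -
  obtain d where d: "d \<in> \<A>" "chart d" "p \<in> fst d"
    using manifold_atlas_chart[OF mfd] .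
  have chc: "chart c" and che: "chart e" using c e by (auto simp: C2_chart_def)
  let ?W = "snd c ` (fst c \<inter> fst d \<inter> fst e)"
  have W: "open ?W"
    using chc d(2) che by (intro open_chart_image) (auto simp: chart_def)
  have inW: "chart_inv c x \<in> fst d \<inter> fst e" if "x \<in> ?W" for x using that chc by auto
  obtain D1 D1' where 1: "C2_derivs (snd c ` (fst c \<inter> fst d)) (snd d \<circ> chart_inv c) D1 D1'"
    using c d(1) by (auto simp: C2_chart_def C2_transition_def C2_on_iff)
  obtain D2 D2' where 2: "C2_derivs (snd d ` (fst d \<inter> fst e)) (snd e \<circ> chart_inv d) D2 D2'"
    using e d(1) by (auto simp: C2_chart_def C2_transition_def C2_on_iff)
  have "(snd d \<circ> chart_inv c) ` ?W \<subseteq> snd d ` (fst d \<inter> fst e)"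
    using inW by auto
  note 3 = C2_derivs_compose[OF 2 C2_derivs_subset[OF 1] this]
  have "C2_derivs ?W (snd e \<circ> chart_inv c)
      (\<lambda>x. D2 ((snd d \<circ> chart_inv c) x) o\<^sub>L D1 x)
      (\<lambda>x. chain2 (D2 ((snd d \<circ> chart_inv c) x)) (D2' ((snd d \<circ> chart_inv c) x)) (D1 x) (D1' x))"
    using inW d(2) by (intro C2_derivs_cong[OF 3 W]) auto
  moreover have "snd c p \<in> ?W" "?W \<subseteq> snd c ` (fst c \<inter> fst e)" using p d by auto
  ultimately show thesis using that W by blast
qed

lemma function_C2_derivs:
  assumes mfd: "C2_manifold \<A>" and f: "C2_function \<A> f" and c: "C2_chart \<A> c" and p: "p \<in> fst c"
  obtains W D D2 where "open W" "snd c p \<in> W" "W \<subseteq> snd c ` fst c"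
    "C2_derivs W (f \<circ> chart_inv c) D D2"
proof -
  obtain d where d: "d \<in> \<A>" "chart d" "p \<in> fst d"
    using manifold_atlas_chart[OF mfd] .
  have chc: "chart c" using c by (auto simp: C2_chart_def)
  let ?W = "snd c ` (fst c \<inter> fst d)"
  have W: "open ?W"
    using chc d(2) by (intro open_chart_image) (auto simp: chart_def)
  have inW: "chart_inv c x \<in> fst d" if "x \<in> ?W" for x using that chc by auto
  obtain D1 D1' where 1: "C2_derivs ?W (snd d \<circ> chart_inv c) D1 D1'"
    using c d(1) by (auto simp: C2_chart_def C2_transition_def C2_on_iff)
  obtain D2 D2' where 2: "C2_derivs (snd d ` fst d) (f \<circ> chart_inv d) D2 D2'"
    using f d(1) by (auto simp: C2_function_def C2_on_iff)
  have "(snd d \<circ> chart_inv c) ` ?W \<subseteq> snd d ` fst d"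
    using inW by auto
  note 3 = C2_derivs_compose[OF 2 1 this]
  have "C2_derivs ?W (f \<circ> chart_inv c)
      (\<lambda>x. D2 ((snd d \<circ> chart_inv c) x) o\<^sub>L D1 x)
      (\<lambda>x. chain2 (D2 ((snd d \<circ> chart_inv c) x)) (D2' ((snd d \<circ> chart_inv c) x)) (D1 x) (D1' x))"
    using inW d(2) by (intro C2_derivs_cong[OF 3 W]) auto
  moreover have "snd c p \<in> ?W" "?W \<subseteq> snd c ` fst c" using p d by auto
  ultimately show thesis using that W by blast
qed

lemma function_change_of_charts:
  assumes mfd: "C2_manifold \<A>" and c: "C2_chart \<A> c" and e: "C2_chart \<A> e"
    and p: "p \<in> fst c" "p \<in> fst e"
    and T: "open T" "snd e p \<in> T" and f: "C2_derivs T (f \<circ> chart_inv e) Dg D2g"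
  obtains S Dh D2h where "open S" "snd c p \<in> S" "S \<subseteq> snd c ` (fst c \<inter> fst e)"
    "C2_derivs S (snd e \<circ> chart_inv c) Dh D2h" "(snd e \<circ> chart_inv c) ` S \<subseteq> T"
    "C2_derivs S (f \<circ> chart_inv c)
      (\<lambda>x. Dg ((snd e \<circ> chart_inv c) x) o\<^sub>L Dh x)
      (\<lambda>x. chain2 (Dg ((snd e \<circ> chart_inv c) x)) (D2g ((snd e \<circ> chart_inv c) x)) (Dh x) (D2h x))"
proof -
  have chc: "chart c" and che: "chart e" using c e by (auto simp: C2_chart_def)
  obtain W Dh D2h where W: "open W" "snd c p \<in> W" "W \<subseteq> snd c ` (fst c \<inter> fst e)"
    and h: "C2_derivs W (snd e \<circ> chart_inv c) Dh D2h"
    using transition_C2_derivs[OF mfd c e p] by blast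
  have "continuous_on W (snd e \<circ> chart_inv c)"
    using h unfolding C2_derivs_def
    by (meson continuous_at_imp_continuous_on has_derivative_continuous)
  then obtain S' where S': "open S'" "S' \<inter> W = (snd e \<circ> chart_inv c) -` T \<inter> W"
    using T(1) W(1) unfolding continuous_on_open_invariant by blast
  define S where "S = S' \<inter> W"
  have "open S" using S'(1) W(1) unfolding S_def by (rule open_Int)
  then have S: "open S" "S \<subseteq> W" "(snd e \<circ> chart_inv c) ` S \<subseteq> T" "snd c p \<in> S"
    using S'(2) W(2) T(2) chc p unfolding S_def by auto
  note h' = C2_derivs_subset[OF h S(2)]
  have "C2_derivs S (f \<circ> chart_inv c)
      (\<lambda>x. Dg ((snd e \<circ> chart_inv c) x) o\<^sub>L Dh x)
      (\<lambda>x. chain2 (Dg ((snd e \<circ> chart_inv c) x)) (D2g ((snd e \<circ> chart_inv c) x)) (Dh x) (D2h x))"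
  proof (rule C2_derivs_cong[OF C2_derivs_compose[OF f h' S(3)] S(1)])
    fix x assume "x \<in> S"
    then have "chart_inv c x \<in> fst e" using S(2) W(3) chc by auto
    then show "((f \<circ> chart_inv e) \<circ> (snd e \<circ> chart_inv c)) x = (f \<circ> chart_inv c) x"
      using che by simp
  qed
  then show thesis using that S h' W(3) by blast
qed

section \<open>Tangent vectors in coordinates\<close>

lemma coord_combination_eq:
  "coord_combination c p \<eta> g =
     (if (g \<circ> chart_inv c) differentiable (at (snd c p))
      then frechet_derivative (g \<circ> chart_inv c) (at (snd c p)) \<eta> else 0)"
proof (cases "(g \<circ> chart_inv c) differentiable (at (snd c p))")
  case True
  let ?d = "frechet_derivative (g \<circ> chart_inv c) (at (snd c p))"
  have lin: "linear ?d"
    using True by (rule linear_frechet_derivative)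
  have "?d \<eta> = ?d (\<Sum>j\<in>UNIV. \<eta> $ j *\<^sub>R axis j 1)"
    using basis_expansion[of \<eta>] by (simp add: scalar_mult_eq_scaleR)
  also have "\<dots> = (\<Sum>j\<in>UNIV. \<eta> $ j * ?d (axis j 1))"
    using lin by (simp add: linear_sum linear_cmul)
  finally show ?thesis using True by (simp add: coord_combination_def coord_vector_def)
next
  case False
  then show ?thesis by (simp add: coord_combination_def coord_vector_def)
qed

lemma coord_combination_has_derivative:
  assumes "((g \<circ> chart_inv c) has_derivative d) (at (snd c p))"
  shows "coord_combination c p \<eta> g = d \<eta>"
  using frechet_derivative_at[OF assms] assms
  by (auto simp: coord_combination_eq differentiable_def)

lemma coord_combination_add:
  "coord_combination c p (u + v) = (\<lambda>g. coord_combination c p u g + coord_combination c p v g)"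
  by (simp add: coord_combination_def fun_eq_iff distrib_right sum.distrib)

lemma coord_combination_scaleR:
  "coord_combination c p (a *\<^sub>R v) = (\<lambda>g. a * coord_combination c p v g)"
  by (simp add: coord_combination_def fun_eq_iff sum_distrib_left mult.assoc)

lemma coord_combination_zero: "coord_combination c p 0 = zero_vector"
  by (simp add: coord_combination_def)

text \<open>The coordinate functions of \<open>c\<close> are the test functions that recover the components.\<close>
lemma coord_combination_inject:
  assumes c: "chart c" "p \<in> fst c" and eq: "coord_combination c p u = coord_combination c p v"
  shows "u = v"
proof -
  have "coord_combination c p w (\<lambda>q. snd c q $ j) = w $ j" for w j
  proof (rule coord_combination_has_derivative)
    show "((\<lambda>q. snd c q $ j) \<circ> chart_inv c has_derivative (\<lambda>w. w $ j)) (at (snd c p))"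
    proof (rule has_derivative_transform_within_open)
      show "((\<lambda>x. x $ j) has_derivative (\<lambda>w. w $ j)) (at (snd c p))"
        by (rule bounded_linear_imp_has_derivative[OF bounded_linear_vec_nth])
      show "open (snd c ` fst c)" "snd c p \<in> snd c ` fst c" using c by (auto simp: chart_def)
    qed (simp add: chart_inv_right)
  qed
  then show ?thesis using eq by (metis vec_eq_iff)
qed

lemma has_derivative_change_of_charts:
  assumes c: "chart c" "p \<in> fst c" and e: "chart e" "p \<in> fst e"
    and h: "((snd e \<circ> chart_inv c) has_derivative h') (at (snd c p))"
    and g: "((g \<circ> chart_inv e) has_derivative g') (at (snd e p))"
  shows "((g \<circ> chart_inv c) has_derivative (g' \<circ> h')) (at (snd c p))"
proof (rule has_derivative_transform_within_open)
  show "((g \<circ> chart_inv e) \<circ> (snd e \<circ> chart_inv c) has_derivative g' \<circ> h') (at (snd c p))"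
    using c g by (intro diff_chain_at h) simp
  show "open (snd c ` (fst c \<inter> fst e))"
    using c e by (intro open_chart_image) (auto simp: chart_def)
  show "snd c p \<in> snd c ` (fst c \<inter> fst e)" using c e by blast
  fix x assume "x \<in> snd c ` (fst c \<inter> fst e)"
  then show "((g \<circ> chart_inv e) \<circ> (snd e \<circ> chart_inv c)) x = (g \<circ> chart_inv c) x"
    using c(1) e(1) by auto
qed

text \<open>The chain rule settles the functions that are differentiable in \<open>e\<close>. For the others both sides are
  0 by convention, because the inverse transition shows that they are not differentiable in \<open>c\<close> either.\<close>
lemma coord_combination_change_of_charts:
  assumes mfd: "C2_manifold \<A>" and c: "C2_chart \<A> c" "p \<in> fst c" and e: "C2_chart \<A> e" "p \<in> fst e"
    and h: "((snd e \<circ> chart_inv c) has_derivative h') (at (snd c p))"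
  shows "coord_combination c p \<eta> = coord_combination e p (h' \<eta>)"
proof
  fix g
  have ch: "chart c" "chart e" using c e by (auto simp: C2_chart_def)
  show "coord_combination c p \<eta> g = coord_combination e p (h' \<eta>) g"
  proof (cases "(g \<circ> chart_inv e) differentiable (at (snd e p))")
    case True
    then obtain g' where g': "((g \<circ> chart_inv e) has_derivative g') (at (snd e p))"
      by (auto simp: differentiable_def)
    show ?thesis
      using coord_combination_has_derivative[OF g']
        coord_combination_has_derivative[OF
          has_derivative_change_of_charts[OF ch(1) c(2) ch(2) e(2) h g']] by simp
  next
    case False
    obtain W D D2 where W: "snd e p \<in> W" "C2_derivs W (snd c \<circ> chart_inv e) D D2"
      using transition_C2_derivs[OF mfd e(1) c(1) e(2) c(2)] by metis
    then have D: "((snd c \<circ> chart_inv e) has_derivative blinfun_apply (D (snd e p))) (at (snd e p))"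
      by (simp add: C2_derivs_def)
    have "\<not> (g \<circ> chart_inv c) differentiable (at (snd c p))"
      using False has_derivative_change_of_charts[OF ch(2) e(2) ch(1) c(2) D, of g]
      unfolding differentiable_def by blast
    then show ?thesis using False by (simp add: coord_combination_eq)
  qed
qed

lemma coord_combination_in_tangent_space:
  "C2_chart \<A> c \<Longrightarrow> p \<in> fst c \<Longrightarrow> coord_combination c p \<eta> \<in> tangent_space \<A> p"
  unfolding tangent_space_def by blast

lemma tangent_space_eq_range:
  assumes mfd: "C2_manifold \<A>" and c: "C2_chart \<A> c" "p \<in> fst c"
  shows "tangent_space \<A> p = range (coord_combination c p)"
proof
  show "range (coord_combination c p) \<subseteq> tangent_space \<A> p"
    using coord_combination_in_tangent_space[OF c] by blast
  show "tangent_space \<A> p \<subseteq> range (coord_combination c p)"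
  proof
    fix v assume "v \<in> tangent_space \<A> p"
    then obtain e \<eta> where e: "C2_chart \<A> e" "p \<in> fst e" "v = coord_combination e p \<eta>"
      by (auto simp: tangent_space_def)
    obtain W D D2 where W: "snd e p \<in> W" "C2_derivs W (snd c \<circ> chart_inv e) D D2"
      using transition_C2_derivs[OF mfd e(1) c(1) e(2) c(2)] by metis
    then have "((snd c \<circ> chart_inv e) has_derivative blinfun_apply (D (snd e p))) (at (snd e p))"
      by (simp add: C2_derivs_def)
    from coord_combination_change_of_charts[OF mfd e(1,2) c this] e(3)
    show "v \<in> range (coord_combination c p)" by blast
  qed
qed

lemma tangent_coords_coord_combination [simp]:
  assumes "chart c" "p \<in> fst c"
  shows "tangent_coords c p (coord_combination c p \<eta>) = \<eta>"
  unfolding tangent_coords_def using coord_combination_inject[OF assms] by blast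

lemma tangent_iso_tangent_coords:
  assumes mfd: "C2_manifold \<A>" and c: "C2_chart \<A> c" "p \<in> fst c"
  shows "tangent_iso \<A> p (tangent_coords c p)"
proof -
  have ch: "chart c" using c by (simp add: C2_chart_def)
  note simps = coord_combination_add[symmetric] coord_combination_scaleR[symmetric]
    tangent_coords_coord_combination[OF ch c(2)]
  have "bij_betw (tangent_coords c p) (range (coord_combination c p)) UNIV"
    by (rule bij_betw_byWitness[of _ "coord_combination c p"]) (auto simp: simps)
  then show ?thesis
    unfolding tangent_iso_def tangent_space_eq_range[OF mfd c] by (auto simp: simps)
qed

text \<open>Whatever isomorphism \<open>T\<^sub>pM \<cong> \<real>\<^sup>n\<close> is used, it differs from the coordinates of \<open>c\<close> by a linear
  automorphism, and the variational form of the Newton step is invariant under it.\<close>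
lemma tangent_newton_in_coords:
  assumes mfd: "C2_manifold \<A>" and c: "C2_chart \<A> c" "p \<in> fst c"
    and G': "((\<lambda>\<eta>. g (coord_combination c p \<eta>)) has_derivative blinfun_apply G') (at 0)"
    and B: "has_second_derivative (\<lambda>\<eta>. g (coord_combination c p \<eta>)) B 0"
    and nondeg: "\<And>u. (\<And>v. B u v = 0) \<Longrightarrow> u = 0"
  shows "\<exists>y. tangent_newton \<A> p g zero_vector = Some (coord_combination c p y) \<and>
             (\<forall>v. B y v = - G' v)"
proof -
  let ?T = "tangent_space \<A> p" and ?cc = "coord_combination c p"
  let ?G = "\<lambda>\<eta>. g (?cc \<eta>)"
  define L where "L = (SOME L. tangent_iso \<A> p L)"
  define L' where "L' = inv_into ?T L"
  have ch: "chart c" using c by (simp add: C2_chart_def)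
  have T: "?T = range ?cc" by (rule tangent_space_eq_range[OF mfd c])
  have "tangent_iso \<A> p L"
    unfolding L_def by (rule someI[of "tangent_iso \<A> p", OF tangent_iso_tangent_coords[OF mfd c]])
  then have bij: "bij_betw L ?T UNIV"
    and add: "\<And>u v. u \<in> ?T \<Longrightarrow> v \<in> ?T \<Longrightarrow> L (\<lambda>g. u g + v g) = L u + L v"
    and scale: "\<And>a v. v \<in> ?T \<Longrightarrow> L (\<lambda>g. a * v g) = a *\<^sub>R L v"
    by (auto simp: tangent_iso_def)
  define Q where "Q = L \<circ> ?cc"
  have "linear Q"
    by (rule linearI) (auto simp: Q_def coord_combination_add coord_combination_scaleR T
        intro!: add scale)
  have "bij_betw ?cc UNIV ?T"
    unfolding T using coord_combination_inject[OF ch c(2)] by (auto simp: bij_betw_def inj_on_def)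
  then have "bij Q" unfolding Q_def using bij by (rule bij_betw_trans)
  define P where "P = Blinfun (inv Q)"
  have "bounded_linear (inv Q)"
    using \<open>linear Q\<close> \<open>bij Q\<close>
    by (auto intro: inj_linear_imp_inv_bounded_linear simp: linear_conv_bounded_linear bij_is_inj)
  then have P: "blinfun_apply P = inv Q"
    unfolding P_def by (rule bounded_linear_Blinfun_apply)
  have L'P: "L' z = ?cc (P z)" for z
  proof -
    have "L (?cc (P z)) = z" using \<open>bij Q\<close> unfolding P by (metis Q_def bij_inv_eq_iff comp_apply)
    moreover have "?cc (P z) \<in> ?T" using T by blast
    ultimately show ?thesis
      unfolding L'_def using bij_betw_imp_inj_on[OF bij] by (metis inv_into_f_f)
  qed
  have L0: "L zero_vector = 0"
    using scale[of "?cc 0" 0] T by simp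
  obtain Dg where Dg: "\<forall>\<^sub>F z in nhds 0. (?G has_derivative blinfun_apply (Dg z)) (at z)"
      "(Dg has_derivative blinfun_apply B) (at 0)"
    using B by (auto simp: has_second_derivative_def)
  have P1: "(blinfun_apply P has_derivative blinfun_apply P) (at z)" for z
    by (rule bounded_linear_imp_has_derivative[OF blinfun.bounded_linear_right])
  have P2: "has_second_derivative (blinfun_apply P) 0 0"
    unfolding has_second_derivative_def
    by (intro exI[of _ "\<lambda>_. P"]) (simp add: P1 zero_blinfun.rep_eq)
  have second: "has_second_derivative (?G \<circ> P) (chain2 (Dg (P 0)) B P 0) 0"
    using Dg by (intro has_second_derivative_compose P1 P2) (simp_all add: blinfun.zero_right)
  have first: "((?G \<circ> P) has_derivative blinfun_apply (G' o\<^sub>L P)) (at 0)"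
    using G' by (intro has_derivative_chain_blinfun P1) (simp add: blinfun.zero_right)
  have surjP: "surj (blinfun_apply P)" and injP: "inj (blinfun_apply P)"
    using bij_imp_bij_inv[OF \<open>bij Q\<close>] by (simp_all add: P bij_is_surj bij_is_inj)
  have "u = 0" if "\<And>v. chain2 (Dg (P 0)) B P 0 u v = 0" for u
  proof -
    have "P u = 0"
    proof (rule nondeg)
      fix v
      obtain w where "v = P w" using surjP by blast
      then show "B (P u) v = 0" using that[of w] by (simp add: blinfun.bilinear_simps)
    qed
    then have "P u = P 0" by (simp add: blinfun.zero_right)
    with injP show "u = 0" by (rule injD)
  qed
  from newton_variational[OF first second this] obtain y where
    y: "newton (?G \<circ> P) 0 = Some y" "\<And>v. chain2 (Dg (P 0)) B P 0 (y - 0) v = - (G' o\<^sub>L P) v"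
    by blast
  have "g \<circ> L' = ?G \<circ> P" by (auto simp: L'P)
  then have "tangent_newton \<A> p g zero_vector = Some (?cc (P y))"
    using y(1) L0 L'P by (simp add: tangent_newton_def L_def[symmetric] L'_def[symmetric])
  moreover have "B (P y) v = - G' v" for v
  proof -
    obtain w where "v = P w" using surjP by blast
    then show ?thesis using y(2)[of w] by (simp add: blinfun.bilinear_simps)
  qed
  ultimately show ?thesis by blast
qed

text \<open>The bundle chart is injective on its domain, so its inverse sends \<open>(x, y)\<close> to the tangent vector
  with components \<open>y\<close> at the point with coordinates \<open>x\<close>.\<close>
lemma local_form_eq:
  assumes mfd: "C2_manifold \<A>" and c: "C2_chart \<A> c" and x: "x \<in> snd c ` fst c"
  shows "local_form \<A> c \<phi> (x, y) =
    (let q = \<phi> (chart_inv c x, coord_combination c (chart_inv c x) y)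
     in if q \<in> fst c then Some (snd c q) else None)"
proof -
  have ch: "chart c" using c by (simp add: C2_chart_def)
  let ?p = "chart_inv c x"
  let ?z = "(?p, coord_combination c ?p y)"
  have p: "?p \<in> fst c" using x by (rule chart_inv_into)
  have z: "?z \<in> bundle_chart_dom \<A> c"
    using p tangent_space_eq_range[OF mfd c p] by (auto simp: bundle_chart_dom_def tangent_bundle_def)
  have bz: "bundle_chart c ?z = (x, y)"
    using p x ch by (simp add: bundle_chart_def chart_inv_right)
  have "inj_on (bundle_chart c) (bundle_chart_dom \<A> c)"
  proof (rule inj_onI)
    fix a b assume ab: "a \<in> bundle_chart_dom \<A> c" "b \<in> bundle_chart_dom \<A> c"
      "bundle_chart c a = bundle_chart c b"
    obtain p v q w where [simp]: "a = (p, v)" "b = (q, w)" by (metis surj_pair)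
    have pq: "p \<in> fst c" "q \<in> fst c" "v \<in> tangent_space \<A> p" "w \<in> tangent_space \<A> q"
      using ab by (auto simp: bundle_chart_dom_def tangent_bundle_def)
    have "snd c p = snd c q" using ab(3) by (simp add: bundle_chart_def)
    then have "p = q" using pq ch chart_inv_left by metis
    moreover have "v = w"
      using pq ab(3) \<open>p = q\<close> tangent_space_eq_range[OF mfd c] ch by (auto simp: bundle_chart_def)
    ultimately show "a = b" by simp
  qed
  then have "inv_into (bundle_chart_dom \<A> c) (bundle_chart c) (x, y) = ?z"
    using z bz by (metis inv_into_f_f)
  moreover have "(x, y) \<in> bundle_chart c ` bundle_chart_dom \<A> c" using z bz by (metis image_eqI)
  ultimately show ?thesis
    by (simp add: local_form_def map_comp_def restrict_map_def Let_def)
qed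

lemma local_form_dom:
  assumes "local_form \<A> c \<phi> (x, y) \<noteq> None"
  shows "x \<in> snd c ` fst c"
  using assms by (auto simp: local_form_def map_comp_def restrict_map_def bundle_chart_def bundle_chart_dom_def
      split: if_splits option.splits)

section \<open>Non-degenerate critical points in coordinates\<close>

lemma critical_point_in_chart:
  assumes "critical_point \<A> f p" and c: "C2_chart \<A> c" "p \<in> fst c"
    and D: "((f \<circ> chart_inv c) has_derivative blinfun_apply D) (at (snd c p))"
  shows "D = 0"
proof (rule blinfun_eqI)
  fix \<eta>
  have "coord_combination c p \<eta> \<in> tangent_space \<A> p" by (rule coord_combination_in_tangent_space[OF c])
  then show "D \<eta> = blinfun_apply 0 \<eta>"
    using assms(1) coord_combination_has_derivative[OF D, of \<eta>]
    unfolding critical_point_def zero_blinfun.rep_eq by metis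
qed

text \<open>At a critical point the first-order term of the chain rule for second derivatives vanishes.
  Hence the Hessian form is the second derivative in any chart.\<close>
lemma hessian_form_in_chart:
  assumes mfd: "C2_manifold \<A>" and f: "C2_function \<A> f" and crit: "critical_point \<A> f p"
    and c: "C2_chart \<A> c" "p \<in> fst c"
  shows "hessian_form \<A> f p (coord_combination c p u) (coord_combination c p v) =
    second_derivative (f \<circ> chart_inv c) (snd c p) u v"
proof -
  have chc: "chart c" using c by (simp add: C2_chart_def)
  have inv: "second_derivative (f \<circ> chart_inv e) (snd e p)
      (tangent_coords e p (coord_combination c p u)) (tangent_coords e p (coord_combination c p v))
     = second_derivative (f \<circ> chart_inv c) (snd c p) u v"
    if e: "C2_chart \<A> e" "p \<in> fst e" for e
  proof -
    let ?h = "snd e \<circ> chart_inv c"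
    have che: "chart e" using e by (simp add: C2_chart_def)
    obtain T Dg D2g where T: "open T" "snd e p \<in> T" and g: "C2_derivs T (f \<circ> chart_inv e) Dg D2g"
      using function_C2_derivs[OF mfd f e] by metis
    obtain S Dh D2h where S: "open S" "snd c p \<in> S" and "S \<subseteq> snd c ` (fst c \<inter> fst e)"
      and h: "C2_derivs S ?h Dh D2h" and "?h ` S \<subseteq> T"
      and fc: "C2_derivs S (f \<circ> chart_inv c) (\<lambda>x. Dg (?h x) o\<^sub>L Dh x)
          (\<lambda>x. chain2 (Dg (?h x)) (D2g (?h x)) (Dh x) (D2h x))"
      by (rule function_change_of_charts[OF mfd c(1) e(1) c(2) e(2) T g])
    have hp: "?h (snd c p) = snd e p" using chc c by simp
    have "Dg (snd e p) = 0"
      using critical_point_in_chart[OF crit e] g T(2) by (simp add: C2_derivs_def)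
    then have "second_derivative (f \<circ> chart_inv c) (snd c p) u v =
        D2g (snd e p) (Dh (snd c p) u) (Dh (snd c p) v)"
      using second_derivative_eqI[OF C2_derivs_has_second_derivative[OF fc S]] hp by simp
    moreover have "second_derivative (f \<circ> chart_inv e) (snd e p) = D2g (snd e p)"
      by (rule second_derivative_eqI[OF C2_derivs_has_second_derivative[OF g T]])
    moreover have "(?h has_derivative blinfun_apply (Dh (snd c p))) (at (snd c p))"
      using h S by (simp add: C2_derivs_def)
    then have "tangent_coords e p (coord_combination c p w) = Dh (snd c p) w" for w
      using coord_combination_change_of_charts[OF mfd c e] che e by simp
    ultimately show ?thesis by simp
  qed
  show ?thesis
    unfolding hessian_form_def
  proof (rule the_equality)
    fix b
    assume "\<forall>e. C2_chart \<A> e \<and> p \<in> fst e \<longrightarrow> b = second_derivative (f \<circ> chart_inv e) (snd e p)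
      (tangent_coords e p (coord_combination c p u)) (tangent_coords e p (coord_combination c p v))"
    then show "b = second_derivative (f \<circ> chart_inv c) (snd c p) u v"
      using inv c by metis
  qed (use inv in auto)
qed

lemma nondegenerate_in_chart:
  assumes mfd: "C2_manifold \<A>" and f: "C2_function \<A> f" and nd: "nondegenerate_critical_point \<A> f p"
    and c: "C2_chart \<A> c" "p \<in> fst c"
    and u: "\<And>v. second_derivative (f \<circ> chart_inv c) (snd c p) u v = 0"
  shows "u = 0"
proof -
  have crit: "critical_point \<A> f p" using nd by (simp add: nondegenerate_critical_point_def)
  have chc: "chart c" using c by (simp add: C2_chart_def)
  have "hessian_form \<A> f p (coord_combination c p u) w = 0" if "w \<in> tangent_space \<A> p" for w
    using that hessian_form_in_chart[OF mfd f crit c] u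
    unfolding tangent_space_eq_range[OF mfd c] by auto
  moreover have "coord_combination c p u \<in> tangent_space \<A> p"
    by (rule coord_combination_in_tangent_space[OF c])
  ultimately have "coord_combination c p u = coord_combination c p 0"
    using nd by (simp add: nondegenerate_critical_point_def coord_combination_zero)
  then show ?thesis using coord_combination_inject[OF chc c(2)] by blast
qed

section \<open>The generalised Newton iteration\<close>

text \<open>By the chain rule and \<open>D\<phi>\<^sub>x(0) = I\<close>, the pulled back function \<open>f \<circ> \<phi>\<^sub>p\<close> has at \<open>0\<close> the
  differential of \<open>f\<close> at \<open>x\<close>, and its Hessian differs from that of \<open>f\<close> by \<open>Df(x) \<circ> D\<^sup>2\<phi>\<^sub>x(0)\<close>.\<close>
lemma tangent_newton_of_pullback:
  assumes mfd: "C2_manifold \<A>" and c: "C2_chart \<A> c"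
    and F: "C2_derivs S (f \<circ> chart_inv c) D D2" "open S" "x \<in> S"
    and H1: "H1 \<rho> (local_form \<A> c \<phi>)" and x: "x \<in> ball 0 \<rho>"
    and E: "has_second_derivative (\<lambda>y. the (local_form \<A> c \<phi> (x, y))) E 0"
    and nondeg: "\<And>u. (\<And>v. chain2 (D x) (D2 x) id_blinfun E u v = 0) \<Longrightarrow> u = 0"
  shows "\<exists>y. tangent_newton \<A> (chart_inv c x) (\<lambda>v. f (\<phi> (chart_inv c x, v))) zero_vector
           = Some (coord_combination c (chart_inv c x) y) \<and>
         (\<forall>v. chain2 (D x) (D2 x) id_blinfun E y v = - D x v)"
proof -
  let ?p = "chart_inv c x" and ?F = "f \<circ> chart_inv c"
  let ?h = "\<lambda>y. the (local_form \<A> c \<phi> (x, y))"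
  let ?G = "\<lambda>\<eta>. f (\<phi> (?p, coord_combination c ?p \<eta>))"
  have ch: "chart c" using c by (simp add: C2_chart_def)
  obtain \<delta> where \<delta>: "\<delta> > 0" "{x} \<times> ball 0 \<delta> \<subseteq> dom (local_form \<A> c \<phi>)"
    and h0: "local_form \<A> c \<phi> (x, 0) = Some x" and h': "(?h has_derivative id) (at 0)"
    using H1 x unfolding H1_def by blast
  have xc: "x \<in> snd c ` fst c" using local_form_dom[of \<A> c \<phi> x 0] h0 by simp
  have p: "?p \<in> fst c" using xc by (rule chart_inv_into)
  have eq: "(?F \<circ> ?h) y = ?G y" if "y \<in> ball 0 \<delta>" for y
  proof -
    have "(x, y) \<in> dom (local_form \<A> c \<phi>)" using \<delta>(2) that by blast
    then show ?thesis
      using ch by (auto simp: local_form_eq[OF mfd c xc] Let_def split: if_splits)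
  qed
  have D: "(?F has_derivative blinfun_apply (D x)) (at x)"
    and D2: "(D has_derivative blinfun_apply (D2 x)) (at x)"
    using F by (auto simp: C2_derivs_def)
  have evD: "\<forall>\<^sub>F z in nhds x. (?F has_derivative blinfun_apply (D z)) (at z)"
    using F by (auto simp: C2_derivs_def eventually_nhds)
  have hx: "?h 0 = x" using h0 by simp
  have id: "(?h has_derivative blinfun_apply id_blinfun) (at 0)"
    using h' by (simp add: id_def id_blinfun.rep_eq)
  have "has_second_derivative (?F \<circ> ?h) (chain2 (D (?h 0)) (D2 x) id_blinfun E) 0"
    by (rule has_second_derivative_compose[where h = ?h and g = ?F and Dg = D]) (use evD D2 id E hx in simp_all)
  then have second: "has_second_derivative ?G (chain2 (D x) (D2 x) id_blinfun E) 0"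
    using has_second_derivative_transform_within_open[of "?F \<circ> ?h" _ 0 "ball 0 \<delta>" ?G] eq \<delta>(1) hx
    by simp
  have "((?F \<circ> ?h) has_derivative blinfun_apply (D x o\<^sub>L id_blinfun)) (at 0)"
    using id D hx by (intro has_derivative_chain_blinfun) simp_all
  then have "(?G has_derivative blinfun_apply (D x o\<^sub>L id_blinfun)) (at 0)"
    by (rule has_derivative_transform_within_open[of _ _ _ _ "ball 0 \<delta>"]) (use eq \<delta>(1) in auto)
  from tangent_newton_in_coords[OF mfd c p this second nondeg]
  show ?thesis by simp
qed

theorem theorem11:
  fixes \<A> :: "('m::{t2_space, second_countable_topology}, 'n::finite) chart set"
    and f :: "'m \<Rightarrow> real"
    and \<phi> \<psi> :: "'m \<times> 'm tangent_vector \<Rightarrow> 'm"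
    and pstar :: 'm
    and U :: "'m set" and \<xi> :: "'m \<Rightarrow> real^'n" and \<eta> :: real
  assumes "C2_manifold \<A>"
    and "C2_function \<A> f"
    and "nondegenerate_critical_point \<A> f pstar"
    and "C2_chart \<A> (U, \<xi>)" and "pstar \<in> U" and "\<xi> pstar = 0" and "\<eta> > 0"
    and "\<And>x. x \<in> \<xi> ` U \<Longrightarrow>
           norm ((hessian (f \<circ> chart_inv (U, \<xi>)) x - hessian (f \<circ> chart_inv (U, \<xi>)) 0) *v x)
             \<le> \<eta> * (norm x)\<^sup>2"
    and "conditions_C1_C2 \<A> \<phi> \<psi>"
  shows "manifold_converges_locally \<A> 2 (generalised_newton \<A> \<phi> \<psi> f) pstar"
proof -
  note mfd = assms(1) and f = assms(2) and nd = assms(3)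
  define e where "e = (U, \<xi>)"
  have e: "C2_chart \<A> e" "pstar \<in> fst e" and e0: "snd e pstar = 0"
    using assms by (auto simp: e_def)
  have hess: "norm ((hessian (f \<circ> chart_inv e) x - hessian (f \<circ> chart_inv e) 0) *v x)
             \<le> \<eta> * (norm x)\<^sup>2" if "x \<in> snd e ` fst e" for x
    using assms(8)[of x] that by (simp add: e_def)
  obtain c \<rho> where c: "C2_chart \<A> c" "pstar \<in> fst c" and c0: "snd c pstar = 0" and \<rho>: "\<rho> > 0"
    and H1: "H1 \<rho> (local_form \<A> c \<phi>)" and H2: "H2 \<rho> (local_form \<A> c \<phi>)"
    and H3: "H3 \<rho> (local_form \<A> c \<psi>)"
    using assms(9) unfolding conditions_C1_C2_def by blast
  have crit: "critical_point \<A> f pstar" using nd by (simp add: nondegenerate_critical_point_def)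
  have ch: "chart c" using c by (simp add: C2_chart_def)

  obtain T Dg D2g where T: "open T" "snd e pstar \<in> T" and Te: "T \<subseteq> snd e ` fst e"
    and g: "C2_derivs T (f \<circ> chart_inv e) Dg D2g"
    using function_C2_derivs[OF mfd f e] by metis
  obtain r where r: "r > 0" "ball 0 r \<subseteq> T" using T e0 open_contains_ball by metis
  have Dg0: "Dg 0 = 0"
    using critical_point_in_chart[OF crit e] g T(2) e0 by (auto simp: C2_derivs_def)
  have "norm (D2g x x - Dg x) \<le> 2 * \<eta> * (norm x)\<^sup>2" if "x \<in> ball 0 r" for x
  proof (rule order_condition_of_hessian_condition[OF g r(2) Dg0 _ _ that])
    fix z :: "real^'n" assume z: "z \<in> ball 0 r"
    have zT: "z \<in> T" "0 \<in> T" using z r T(2) e0 by auto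
    show "norm ((D2g z - D2g 0) z) \<le> \<eta> * (norm z)\<^sup>2"
      using zT Te
      by (intro hessian_condition_bilinear[OF C2_derivs_has_second_derivative[OF g T(1)]
            C2_derivs_has_second_derivative[OF g T(1)] hess]) auto
  qed (use assms(7) in simp)
  note oc_e = this

  \<comment> \<open>\<open>h\<close> passes from the chart of the conditions on \<open>\<phi>\<close> and \<open>\<psi>\<close> to the chart of the Hessian hypothesis.\<close>
  define h where "h = snd e \<circ> chart_inv c"
  obtain S Dh D2h where S: "open S" "snd c pstar \<in> S" and Sc: "S \<subseteq> snd c ` (fst c \<inter> fst e)"
    and h: "C2_derivs S h Dh D2h" and hS: "h ` S \<subseteq> T"
    and fc: "C2_derivs S (f \<circ> chart_inv c) (\<lambda>x. Dg (h x) o\<^sub>L Dh x)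
          (\<lambda>x. chain2 (Dg (h x)) (D2g (h x)) (Dh x) (D2h x))"
    unfolding h_def by (rule function_change_of_charts[OF mfd c(1) e(1) c(2) e(2) T g])
  define D where "D = (\<lambda>x. Dg (h x) o\<^sub>L Dh x)"
  define D2 where "D2 = (\<lambda>x. chain2 (Dg (h x)) (D2g (h x)) (Dh x) (D2h x))"
  note F = fc[folded D_def D2_def]
  have S0: "0 \<in> S" using S c0 by simp
  have h0: "h 0 = 0" using c0 e0 chart_inv_left[OF ch c(2)] by (simp add: h_def)
  obtain s1 C where s1: "s1 > 0" "C \<ge> 0"
    "\<And>x. x \<in> ball 0 s1 \<Longrightarrow> norm (D2 x x - D x) \<le> C * (norm x)\<^sup>2"
    unfolding D_def D2_def
    by (rule order_condition_compose[OF g T(1) h S(1) hS S0 h0 Dg0 oc_e r(1)])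
       (use assms(7) in auto)
  have D0: "D 0 = 0" by (simp add: D_def h0 Dg0)
  have nondeg: "u = 0" if "\<And>v. D2 0 u v = 0" for u
    using nondegenerate_in_chart[OF mfd f nd c, of u] that c0
      second_derivative_eqI[OF C2_derivs_has_second_derivative[OF F S(1) S0]] by simp

  obtain \<alpha>0 where \<alpha>0: "\<And>x. x \<in> ball 0 \<rho> \<Longrightarrow>
      \<exists>E. has_second_derivative (\<lambda>y. the (local_form \<A> c \<phi> (x, y))) E 0 \<and> second_derivative_norm E \<le> \<alpha>0"
    using H2 unfolding H2_def by blast
  \<comment> \<open>The factor 2 is the one of the polarisation bound.\<close>
  define \<alpha> where "\<alpha> = 2 * max 0 \<alpha>0"
  have \<alpha>: "\<alpha> \<ge> 0" by (simp add: \<alpha>_def)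
  obtain s2 K where s2: "s2 > 0" "K \<ge> 0" "ball 0 s2 \<subseteq> S"
    and K: "\<And>x E. x \<in> ball 0 s2 \<Longrightarrow> \<forall>u v. norm (blinfun_apply (blinfun_apply E u) v) \<le> \<alpha> * norm u * norm v \<Longrightarrow>
       (\<forall>u. (\<forall>v. chain2 (D x) (D2 x) id_blinfun E u v = 0) \<longrightarrow> u = 0) \<and>
       (\<forall>y. (\<forall>v. chain2 (D x) (D2 x) id_blinfun E y v = - D x v) \<longrightarrow> norm (x + y) \<le> K * (norm x)\<^sup>2)"
    by (rule perturbed_newton_step_estimate[OF F S(1) S0 D0 nondeg s1(3) s1(1,2) \<alpha>]) blast+

  have step: "\<exists>y. tangent_newton \<A> (chart_inv c x) (\<lambda>v. f (\<phi> (chart_inv c x, v))) zero_vector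
           = Some (coord_combination c (chart_inv c x) y) \<and> norm (x + y) \<le> K * (norm x)\<^sup>2"
    if x: "x \<in> ball 0 s2" "x \<in> ball 0 \<rho>" for x
  proof -
    obtain E where E: "has_second_derivative (\<lambda>y. the (local_form \<A> c \<phi> (x, y))) E 0"
      "second_derivative_norm E \<le> max 0 \<alpha>0"
      using \<alpha>0[OF x(2)] by force
    have "norm (E u v) \<le> \<alpha> * norm u * norm v" for u v
      unfolding \<alpha>_def
      by (rule bilinear_bound_of_quadratic_bound[OF second_derivative_symmetric[OF E(1)]
            quadratic_bound_of_second_derivative_norm[OF E(2)]]) simp
    with K[OF x(1), of E]
    have K': "\<And>u. (\<And>v. chain2 (D x) (D2 x) id_blinfun E u v = 0) \<Longrightarrow> u = 0"
      "\<And>y. (\<And>v. chain2 (D x) (D2 x) id_blinfun E y v = - D x v) \<Longrightarrow> norm (x + y) \<le> K * (norm x)\<^sup>2"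
      by blast+
    have "x \<in> S" using x s2(3) by blast
    from tangent_newton_of_pullback[OF mfd c(1) F S(1) this H1 x(2) E(1) K'(1)] K'(2)
    show ?thesis by blast
  qed

  obtain \<beta>0 where \<beta>0: "\<And>x y. x \<in> ball 0 \<rho> \<Longrightarrow> y \<in> ball 0 \<rho> \<Longrightarrow>
      norm (the (local_form \<A> c \<psi> (x, y)) - x - y) \<le> \<beta>0 * (norm y)\<^sup>2"
    and domH3: "ball 0 \<rho> \<times> ball 0 \<rho> \<subseteq> dom (local_form \<A> c \<psi>)"
    using H3 unfolding H3_def by blast
  define \<beta> where "\<beta> = max 0 \<beta>0"
  define \<kappa> where "\<kappa> = \<beta> * (1 + K)\<^sup>2 + K"
  have \<kappa>: "\<kappa> \<ge> 0" using s2(2) by (simp add: \<kappa>_def \<beta>_def)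
  \<comment> \<open>Radius 1 gives \<open>\<parallel>y\<parallel> \<le> (1 + K) \<parallel>x\<parallel>\<close>, \<open>\<rho> / (1 + K)\<close> keeps \<open>y\<close> in the domain of \<open>\<psi>\<close>, and
    \<open>1 / (\<kappa> + 1)\<close> makes the ball invariant.\<close>
  define s where "s = min (min 1 s2) (min (\<rho> / (1 + K)) (1 / (\<kappa> + 1)))"
  have s: "s > 0" using s2 \<rho> \<kappa> by (simp add: s_def)
  have s\<rho>: "s \<le> \<rho>"
  proof -
    have "\<rho> / (1 + K) \<le> \<rho>" using \<rho> s2(2) by (simp add: field_simps)
    then show ?thesis by (simp add: s_def)
  qed
  let ?E = "((Some \<circ> snd c) |` fst c) \<circ>\<^sub>m generalised_newton \<A> \<phi> \<psi> f
      \<circ>\<^sub>m ((Some \<circ> chart_inv c) |` (snd c ` fst c))"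
  have main: "\<exists>z. ?E x = Some z \<and> norm z \<le> \<kappa> * (norm x)\<^sup>2 \<and> norm z < s" if x: "x \<in> ball 0 s" for x
  proof -
    let ?p = "chart_inv c x"
    have nx: "norm x \<le> 1" "norm x < s" using x by (auto simp: s_def)
    have xs: "x \<in> ball 0 s2" "x \<in> ball 0 \<rho>" using x s\<rho> by (auto simp: s_def)
    have xc: "x \<in> snd c ` fst c" using xs(1) s2(3) Sc by blast
    obtain y where y: "tangent_newton \<A> ?p (\<lambda>v. f (\<phi> (?p, v))) zero_vector
        = Some (coord_combination c ?p y)" and xy: "norm (x + y) \<le> K * (norm x)\<^sup>2"
      using step[OF xs] by blast
    have "norm y \<le> norm (x + y) + norm x"
      using norm_triangle_ineq4[of "x + y" x] by simp
    also have "\<dots> \<le> K * norm x + norm x"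
    proof -
      have "(norm x)\<^sup>2 \<le> norm x" using nx(1) by (simp add: power2_eq_square mult_left_le)
      then have "K * (norm x)\<^sup>2 \<le> K * norm x" using s2(2) by (rule mult_left_mono)
      then show ?thesis using xy by linarith
    qed
    finally have ny: "norm y \<le> (1 + K) * norm x" by (simp add: algebra_simps)
    have "norm x < \<rho> / (1 + K)" using nx(2) by (simp add: s_def)
    then have "(1 + K) * norm x < \<rho>" using s2(2) by (simp add: field_simps)
    then have yr: "y \<in> ball 0 \<rho>" using ny by simp
    obtain z where z: "local_form \<A> c \<psi> (x, y) = Some z"
      using domH3 xs(2) yr by blast
    then have \<psi>: "\<psi> (?p, coord_combination c ?p y) \<in> fst c"
        "z = snd c (\<psi> (?p, coord_combination c ?p y))"
      by (auto simp: local_form_eq[OF mfd c(1) xc] Let_def split: if_splits)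
    have "?E x = Some z"
      using xc y \<psi> by (simp add: map_comp_def generalised_newton_def)
    moreover have nz: "norm z \<le> \<kappa> * (norm x)\<^sup>2"
    proof -
      have "norm (z - x - y) \<le> \<beta>0 * (norm y)\<^sup>2" using \<beta>0[OF xs(2) yr] z by simp
      also have "\<dots> \<le> \<beta> * ((1 + K) * norm x)\<^sup>2"
        using ny by (intro mult_mono power_mono) (auto simp: \<beta>_def)
      finally have "norm (z - x - y) \<le> \<beta> * (1 + K)\<^sup>2 * (norm x)\<^sup>2"
        by (simp add: power_mult_distrib)
      moreover have "norm z \<le> norm (z - x - y) + norm (x + y)"
        using norm_triangle_ineq[of "z - x - y" "x + y"] by simp
      ultimately show ?thesis using xy by (simp add: \<kappa>_def distrib_right)
    qed
    moreover have "norm z < s"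
    proof -
      have "norm x < 1 / (\<kappa> + 1)" using nx(2) by (simp add: s_def)
      then have "\<kappa> * norm x + norm x < 1" using \<kappa> by (simp add: field_simps)
      then have "\<kappa> * norm x \<le> 1" using norm_ge_zero[of x] by linarith
      then have "\<kappa> * norm x * norm x \<le> norm x" using mult_right_mono[of "\<kappa> * norm x" 1 "norm x"] by simp
      then show ?thesis using nz nx(2) by (simp add: power2_eq_square)
    qed
    ultimately show ?thesis by blast
  qed
  have "converges_locally 2 ?E (snd c pstar)"
    unfolding converges_locally_def
  proof (intro conjI exI[of _ \<kappa>] exI[of _ "ball 0 s"] ballI)
    fix x :: "real^'n" assume "x \<in> ball 0 s"
    from main[OF this] obtain z where "?E x = Some z" "norm z \<le> \<kappa> * (norm x)\<^sup>2" "norm z < s"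
      by blast
    moreover have "norm x powr 2 = (norm x)\<^sup>2" by (simp add: powr_numeral)
    ultimately show "\<exists>y. ?E x = Some y \<and> y \<in> ball 0 s \<and>
        norm (y - snd c pstar) \<le> \<kappa> * norm (x - snd c pstar) powr 2"
      by (simp add: c0)
  qed (use s c0 in auto)
  then show ?thesis unfolding manifold_converges_locally_def using c by blast
qed

end
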